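(* Let $\mathscr{B}\subset\mathbb{R}^3$ be a bounded region, let $K_{11},K_{22},K_{33},K_{24}\in\mathbb{R}$, and let $\mathscr{F}_{\mathrm F}[\bm n]=\int_{\mathscr{B}}W_{\mathrm F}(\bm n,\nabla\bm n)\,dV$ be Frank's elastic free energy, with $$W_{\mathrm F}(\bm n,\nabla\bm n)=\tfrac12K_{11}(\operatorname{div}\bm n)^2+\tfrac12K_{22}(\bm n\cdot\operatorname{curl}\bm n)^2+\tfrac12K_{33}|\bm n\times\operatorname{curl}\bm n|^2+K_{24}\left[\operatorname{tr}(\nabla\bm n)^2-(\operatorname{div}\bm n)^2\right].$$ Let $\varepsilon>0$ and let $(t,\bm x)\mapsto\bm n_t(\bm x)\in\mathbb{S}^2$, $t\in(-\varepsilon,\varepsilon)$, $\bm x\in\overline{\mathscr{B}}$, be a smooth family (up to the boundary of $\mathscr{B}$) of unit vector fields with $\bm n_0=\bm n$. Set $\bm v:=\partial_t\bm n_t|_{t=0}$, $v^2:=\bm v\cdot\bm v$. Then $\bm v\cdot\bm n=0$, and $\partial_t^2\bm n_t|_{t=0}=\bm w-v^2\bm n$ for a vector field $\bm w$ with $\bm w\cdot\bm n=0$. Moreover, the second variation $\delta^2\mathscr{F}_{\mathrm F}(\bm n)[\bm v,\bm w]:=\frac{d^2}{dt^2}\mathscr{F}_{\mathrm F}[\bm n_t]\big|_{t=0}$ is given by $$\begin{aligned} \delta^2\mathscr{F}_{\mathrm F}(\bm n)[\bm v,\bm w]=\;&\delta\mathscr{F}_{\mathrm F}(\bm n)[\bm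 w]+\int_{\mathscr{B}}\Big\{(K_{11}-2K_{24})\left[(\operatorname{div}\bm v)^2-v^2(\operatorname{div}\bm n)^2-(\operatorname{div}\bm n)\,\bm n\cdot\nabla v^2\right]\\ &+K_{22}\left[(\bm v\cdot\operatorname{curl}\bm n+\bm n\cdot\operatorname{curl}\bm v)^2+2(\bm n\cdot\operatorname{curl}\bm n)(\bm v\cdot\operatorname{curl}\bm v-v^2\,\bm n\cdot\operatorname{curl}\bm n)\right]\\ &+K_{33}\left[|\bm v\times\operatorname{curl}\bm n+\bm n\times\operatorname{curl}\bm v|^2+(\bm n\times\operatorname{curl}\bm n)\cdot(2\bm v\times\operatorname{curl}\bm v-2v^2\,\bm n\times\operatorname{curl}\bm n-\nabla v^2)\right]\\ &+2K_{24}\left[\operatorname{tr}(\nabla\bm v)^2-v^2\operatorname{tr}(\nabla\bm n)^2+(\bm n\times\operatorname{curl}\bm n)\cdot\nabla v^2\right]\Big\}\,dV, \end{aligned}$$ where $\delta\mathscr{F}_{\mathrm F}(\bm n)[\bm w]$ denotes the first variation of $\mathscr{F}_{\mathrm F}$ at $\bm n$ evaluated on $\bm w$, $$\begin{aligned} \delta\mathscr{F}_{\mathrm F}(\bm n)[\bm w]=\int_{\mathscr{B}}\Big\{&K_{11}\operatorname{div}\bm n\operatorname{div}\bm w+K_{22}(\bm n\cdot\operatorname{curl}\bm n)(\bm w\cdot\operatorname{curl}\bm n+\bm n\cdot\operatorname{curl}\bm w)\\ &+K_{33}(\bm n\times\operatorname{curl}\bm n)\cdot(\bm w\times\operatorname{curl}\bm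 n+\bm n\times\operatorname{curl}\bm w)+2K_{24}\left[\operatorname{tr}(\nabla\bm n\nabla\bm w)-\operatorname{div}\bm n\operatorname{div}\bm w\right]\Big\}\,dV. \end{aligned}$$
   Context: For a vector field $\bm u$ on a region of $\mathbb{R}^3$, $\nabla\bm u$ is the $3\times3$ matrix with entries $(\nabla\bm u)_{ij}=\partial_j u_i$, $\operatorname{tr}(\nabla\bm u)^2$ means the trace of the matrix square $(\nabla\bm u)(\nabla\bm u)$, and $\nabla v^2$ is the gradient of the scalar field $v^2$. $\mathbb{S}^2$ is the unit sphere in $\mathbb{R}^3$. *)

theory Defs
  imports "HOL-Analysis.Analysis"
begin

section \<open>Differential operators on \<open>\<real>\<^sup>3\<close>\<close>

text \<open>The library's \<^const>\<open>jacobian\<close> has the entries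
  \<open>jacobian u (at x) $ i $ j = \<partial>\<^sub>j u\<^sub>i\<close>.\<close>

definition nabla :: "(real^3 \<Rightarrow> real^3) \<Rightarrow> real^3 \<Rightarrow> real^3^3" where
  "nabla u x = jacobian u (at x)"

definition div_field :: "(real^3 \<Rightarrow> real^3) \<Rightarrow> real^3 \<Rightarrow> real" where
  "div_field u x = trace (nabla u x)"

definition curl :: "(real^3 \<Rightarrow> real^3) \<Rightarrow> real^3 \<Rightarrow> real^3" where
  "curl u x = vector
     [nabla u x $ 3 $ 2 - nabla u x $ 2 $ 3,
      nabla u x $ 1 $ 3 - nabla u x $ 3 $ 1,
      nabla u x $ 2 $ 1 - nabla u x $ 1 $ 2]"

definition grad :: "(real^3 \<Rightarrow> real) \<Rightarrow> real^3 \<Rightarrow> real^3" where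
  "grad f x = (\<chi> j. frechet_derivative f (at x) (axis j 1))"


section \<open>Smoothness up to the boundary\<close>

fun iterated_partial ::
    "'a::euclidean_space list \<Rightarrow> ('a \<Rightarrow> 'b::real_normed_vector) \<Rightarrow> 'a \<Rightarrow> 'b" where
  "iterated_partial [] f = f"
| "iterated_partial (b # bs) f = (\<lambda>x. frechet_derivative (iterated_partial bs f) (at x) b)"

text \<open>Intended for \<open>U\<close> open and \<open>U \<subseteq> C \<subseteq> closure U\<close>: all partial derivatives of all orders
  exist in \<open>U\<close> and extend continuously to \<open>C\<close>; the extension of \<open>f\<close> itself (order zero)
  is given by its values on \<open>C\<close>.\<close>

definition smooth_up_to ::
    "'a::euclidean_space set \<Rightarrow> 'a set \<Rightarrow> ('a \<Rightarrow> 'b::real_normed_vector) \<Rightarrow> bool" where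
  "smooth_up_to U C f \<longleftrightarrow>
     continuous_on C f \<and>
     (\<forall>bs \<in> lists Basis.
        iterated_partial bs f differentiable_on U \<and>
        (\<exists>g. continuous_on C g \<and> (\<forall>x\<in>U. g x = iterated_partial bs f x)))"


section \<open>Variations of unit vector fields\<close>

text \<open>A smooth (up to the boundary of \<open>B\<close>) family \<open>N t\<close>, \<open>-\<epsilon> < t < \<epsilon>\<close>, of unit vector fields
  on the closure of \<open>B\<close> with \<open>N 0 = n\<close> there.\<close>

definition unit_field_family ::
    "(real^3) set \<Rightarrow> real \<Rightarrow> (real^3 \<Rightarrow> real^3) \<Rightarrow> (real \<Rightarrow> real^3 \<Rightarrow> real^3) \<Rightarrow> bool" where
  "unit_field_family B \<epsilon> n N \<longleftrightarrow>
     0 < \<epsilon> \<and>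
     smooth_up_to (Sigma {-\<epsilon><..<\<epsilon>} (\<lambda>_. B)) (Sigma {-\<epsilon><..<\<epsilon>} (\<lambda>_. closure B))
       (\<lambda>(t, x). N t x) \<and>
     (\<forall>t\<in>{-\<epsilon><..<\<epsilon>}. \<forall>x\<in>closure B. norm (N t x) = 1) \<and>
     (\<forall>x\<in>closure B. N 0 x = n x)"

definition velocity :: "(real \<Rightarrow> real^3 \<Rightarrow> real^3) \<Rightarrow> real \<Rightarrow> real^3 \<Rightarrow> real^3" where
  "velocity N t x = vector_derivative (\<lambda>s. N s x) (at t)"

definition acceleration :: "(real \<Rightarrow> real^3 \<Rightarrow> real^3) \<Rightarrow> real \<Rightarrow> real^3 \<Rightarrow> real^3" where
  "acceleration N t x = vector_derivative (\<lambda>s. velocity N s x) (at t)"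

text \<open>\<open>D\<close> is the first variation of the functional \<open>E\<close> at \<open>n\<close> evaluated on \<open>w\<close>: the derivative
  of \<open>E\<close> along every family of unit fields through \<open>n\<close> with initial velocity \<open>w\<close>. The
  existence clause excludes fields \<open>w\<close> for which there is no such family.\<close>

definition has_first_variation ::
    "((real^3 \<Rightarrow> real^3) \<Rightarrow> real) \<Rightarrow> (real^3) set \<Rightarrow>
     (real^3 \<Rightarrow> real^3) \<Rightarrow> (real^3 \<Rightarrow> real^3) \<Rightarrow> real \<Rightarrow> bool" where
  "has_first_variation E B n w D \<longleftrightarrow>
     (\<exists>\<epsilon> N. unit_field_family B \<epsilon> n N \<and> (\<forall>x\<in>closure B. velocity N 0 x = w x)) \<and>
     (\<forall>\<epsilon> N. unit_field_family B \<epsilon> n N \<and> (\<forall>x\<in>closure B. velocity N 0 x = w x) \<longrightarrow>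
        ((\<lambda>t. E (N t)) has_real_derivative D) (at 0))"

definition first_variation ::
    "((real^3 \<Rightarrow> real^3) \<Rightarrow> real) \<Rightarrow> (real^3) set \<Rightarrow>
     (real^3 \<Rightarrow> real^3) \<Rightarrow> (real^3 \<Rightarrow> real^3) \<Rightarrow> real" where
  "first_variation E B n w = (THE D. has_first_variation E B n w D)"


section \<open>Frank's elastic free energy\<close>

definition frank_density ::
    "real \<Rightarrow> real \<Rightarrow> real \<Rightarrow> real \<Rightarrow> (real^3 \<Rightarrow> real^3) \<Rightarrow> real^3 \<Rightarrow> real" where
  "frank_density K11 K22 K33 K24 n x =
     1/2 * K11 * (div_field n x)\<^sup>2
     + 1/2 * K22 * (n x \<bullet> curl n x)\<^sup>2
     + 1/2 * K33 * (norm (cross3 (n x) (curl n x)))\<^sup>2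
     + K24 * (trace (nabla n x ** nabla n x) - (div_field n x)\<^sup>2)"

definition frank_energy ::
    "real \<Rightarrow> real \<Rightarrow> real \<Rightarrow> real \<Rightarrow> (real^3) set \<Rightarrow> (real^3 \<Rightarrow> real^3) \<Rightarrow> real" where
  "frank_energy K11 K22 K33 K24 B n = (LINT x:B|lborel. frank_density K11 K22 K33 K24 n x)"

end

theory Submission
  imports Defs
begin

text \<open>Differentiating \<open>|n\<^sub>t|\<^sup>2 = 1\<close> twice gives \<open>v \<bullet> n = 0\<close> and \<open>a \<bullet> n = - v\<^sup>2\<close> for the acceleration
  \<open>a\<close>, hence \<open>a = w - v\<^sup>2 n\<close> with \<open>w \<bullet> n = 0\<close>. The energy density is a polynomial in \<open>n\<close> and
  \<open>M = \<nabla>n\<close>; differentiating twice under the integral sign yields its first variation along the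
  acceleration plus a quadratic form in \<open>(v, \<nabla>v)\<close>. Substituting
  \<open>\<nabla>a = \<nabla>w - v\<^sup>2 \<nabla>n - n \<otimes> \<nabla>v\<^sup>2\<close> and using \<open>(\<nabla>n)\<^sup>T n = 0\<close>, which turns \<open>(\<nabla>n) n\<close> into
  \<open>curl n \<times> n\<close>, splits off the first variation along \<open>w\<close>. Since \<open>w\<close> is itself the initial velocity
  of a family of unit fields, that first variation is well defined.\<close>

section \<open>Functions of class \<open>C\<^sup>k\<close> up to the boundary\<close>

text \<open>Derivatives in space exist only inside the open set \<open>B\<close>, whose boundary is
  arbitrary; on \<open>closure B\<close> only their continuous extensions are available. So every
  integrand is paired with a continuous extension, compactness of the closure supplies the bound for
  differentiating under the integral, and velocity and acceleration at boundary points need a limit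
  argument. The second obstacle is \<open>has_first_variation\<close>: besides the value of the
  derivative it demands an actual family of unit fields whose initial velocity is \<open>w\<close>.
  Such a family is built by an explicit rational formula in \<open>t\<close>, \<open>n\<close> and
  \<open>w\<close>, and its smoothness is what the calculus of \<open>Ck_up_to\<close> is for;
  estimating iterated partial derivatives of a quotient directly would be unmanageable. The
  coefficient \<open>K11 - 2 * K24\<close> in the result collects the squares of the divergence: in
  the density they carry \<open>K11 / 2\<close> from splay and \<open>- K24\<close> from the
  saddle-splay term.\<close>

text \<open>Recursion through the first partial derivatives, rather than the iterated ones, makes closure
  under products, quotients and substitutions an induction on \<open>k\<close>.\<close>

primrec Ck_up_to ::
    "nat \<Rightarrow> 'a::euclidean_space set \<Rightarrow> 'a set \<Rightarrow> ('a \<Rightarrow> 'b::real_normed_vector) \<Rightarrow> bool" where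
  "Ck_up_to 0 U C f \<longleftrightarrow> continuous_on C f"
| "Ck_up_to (Suc k) U C f \<longleftrightarrow> continuous_on C f \<and>
     (\<exists>G. \<forall>b\<in>Basis. Ck_up_to k U C (G b) \<and>
        (\<forall>x\<in>U. (f has_derivative (\<lambda>h. \<Sum>b\<in>Basis. (h \<bullet> b) *\<^sub>R G b x)) (at x)))"

text \<open>A linear map is determined by its values on \<open>Basis\<close>, so a derivative
  \<open>D x\<close> in whatever form the standard rules produce can replace the basis expansion
  demanded by the recursion.\<close>

lemma Ck_up_to_SucI:
  fixes G :: "'a::euclidean_space \<Rightarrow> 'a \<Rightarrow> 'b::real_normed_vector"
  assumes "continuous_on C f" "\<And>b. b \<in> Basis \<Longrightarrow> Ck_up_to k U C (G b)"
    and "\<And>x. x \<in> U \<Longrightarrow> (f has_derivative D x) (at x)"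
    and "\<And>x b. x \<in> U \<Longrightarrow> b \<in> Basis \<Longrightarrow> D x b = G b x"
  shows "Ck_up_to (Suc k) U C f"
proof -
  have "D x = (\<lambda>h. \<Sum>b\<in>Basis. (h \<bullet> b) *\<^sub>R G b x)" if "x \<in> U" for x
  proof
    fix h
    have lin: "linear (D x)"
      using assms(3)[OF that] by (rule has_derivative_linear)
    have "D x h = D x (\<Sum>b\<in>Basis. (h \<bullet> b) *\<^sub>R b)"
      by (simp add: euclidean_representation)
    also have "\<dots> = (\<Sum>b\<in>Basis. (h \<bullet> b) *\<^sub>R G b x)"
      using assms(4) that by (simp add: linear_sum[OF lin] linear_cmul[OF lin])
    finally show "D x h = (\<Sum>b\<in>Basis. (h \<bullet> b) *\<^sub>R G b x)" .
  qed
  then show ?thesis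
    using assms by auto
qed

lemma Ck_up_to_SucE:
  fixes f :: "'a::euclidean_space \<Rightarrow> 'b::real_normed_vector"
  assumes "Ck_up_to (Suc k) U C f"
  obtains G D where "continuous_on C f" "\<And>b. b \<in> Basis \<Longrightarrow> Ck_up_to k U C (G b)"
    and "\<And>x. x \<in> U \<Longrightarrow> (f has_derivative D x) (at x)"
    and "\<And>x b. x \<in> U \<Longrightarrow> b \<in> Basis \<Longrightarrow> D x b = G b x"
proof -
  obtain G where f: "continuous_on C f"
    and G': "\<forall>b\<in>Basis. Ck_up_to k U C (G b) \<and>
        (\<forall>x\<in>U. (f has_derivative (\<lambda>h. \<Sum>b\<in>Basis. (h \<bullet> b) *\<^sub>R G b x)) (at x))"
    using assms unfolding Ck_up_to.simps by blast
  then have G: "Ck_up_to k U C (G b)" if "b \<in> Basis" for b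
    using that by blast
  have "(\<Sum>b'\<in>Basis. (b \<bullet> b') *\<^sub>R G b' x) = G b x" if "b \<in> Basis" for x b
  proof -
    have "(\<Sum>b'\<in>Basis. (b \<bullet> b') *\<^sub>R G b' x) = (\<Sum>b'\<in>Basis. if b = b' then G b' x else 0)"
      using that by (intro sum.cong) (auto simp: inner_Basis)
    then show ?thesis using that by simp
  qed
  \<comment> \<open>In the recursion this clause stands under the quantifier over \<open>b\<close>,
    so some basis vector must exist before it can be extracted.\<close>
  moreover have "(f has_derivative (\<lambda>h. \<Sum>b\<in>Basis. (h \<bullet> b) *\<^sub>R G b x)) (at x)" if "x \<in> U" for x
    using G' that nonempty_Basis by blast
  ultimately show ?thesis
    by (intro that[of G "\<lambda>x h. \<Sum>b\<in>Basis. (h \<bullet> b) *\<^sub>R G b x"] f G)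
qed

lemma Ck_up_to_continuous_on: "Ck_up_to k U C f \<Longrightarrow> continuous_on C f"
  by (cases k) auto

lemma Ck_up_to_decrease: "Ck_up_to (Suc k) U C f \<Longrightarrow> Ck_up_to k U C f"
proof (induction k arbitrary: f)
  case 0
  then show ?case by simp
next
  case (Suc k)
  from Suc.prems obtain D G where "continuous_on C f" "\<And>b. b \<in> Basis \<Longrightarrow> Ck_up_to (Suc k) U C (G b)"
    "\<And>x. x \<in> U \<Longrightarrow> (f has_derivative D x) (at x)"
    "\<And>x b. x \<in> U \<Longrightarrow> b \<in> Basis \<Longrightarrow> D x b = G b x"
    by (rule Ck_up_to_SucE) (rule that)
  then show ?case by (intro Ck_up_to_SucI[of C f k U G D] Suc.IH) auto
qed

lemma Ck_up_to_const: "Ck_up_to k U C (\<lambda>x. c)"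
proof (induction k arbitrary: c)
  case (Suc k)
  show ?case by (rule Ck_up_to_SucI[where G = "\<lambda>b x. 0" and D = "\<lambda>x h. 0"]) (use Suc in auto)
qed simp

lemma Ck_up_to_add:
  "Ck_up_to k U C f \<Longrightarrow> Ck_up_to k U C g \<Longrightarrow> Ck_up_to k U C (\<lambda>x. f x + g x)"
proof (induction k arbitrary: f g)
  case 0
  then show ?case by (auto intro: continuous_intros)
next
  case (Suc k)
  from Suc.prems(1) obtain D G where f: "continuous_on C f" "\<And>b. b \<in> Basis \<Longrightarrow> Ck_up_to k U C (G b)"
    "\<And>x. x \<in> U \<Longrightarrow> (f has_derivative D x) (at x)"
    "\<And>x b. x \<in> U \<Longrightarrow> b \<in> Basis \<Longrightarrow> D x b = G b x"
    by (rule Ck_up_to_SucE) (rule that)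
  from Suc.prems(2) obtain D' G' where g: "continuous_on C g" "\<And>b. b \<in> Basis \<Longrightarrow> Ck_up_to k U C (G' b)"
    "\<And>x. x \<in> U \<Longrightarrow> (g has_derivative D' x) (at x)"
    "\<And>x b. x \<in> U \<Longrightarrow> b \<in> Basis \<Longrightarrow> D' x b = G' b x"
    by (rule Ck_up_to_SucE) (rule that)
  show ?case
    by (rule Ck_up_to_SucI[where G = "\<lambda>b x. G b x + G' b x" and D = "\<lambda>x h. D x h + D' x h"])
      (use f g Suc.IH in \<open>auto intro!: continuous_intros has_derivative_add\<close>)
qed

text \<open>Stated for any bounded bilinear \<open>p\<close> so that one induction serves products
  of reals, scalar multiplication and inner products.\<close>

lemma Ck_up_to_bilinear:
  assumes "bounded_bilinear p"
  shows "Ck_up_to k U C f \<Longrightarrow> Ck_up_to k U C g \<Longrightarrow> Ck_up_to k U C (\<lambda>x. p (f x) (g x))"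
proof (induction k arbitrary: f g)
  case 0
  then show ?case by (auto intro: bounded_bilinear.continuous_on[OF assms])
next
  case (Suc k)
  from Suc.prems(1) obtain D G where f: "continuous_on C f" "\<And>b. b \<in> Basis \<Longrightarrow> Ck_up_to k U C (G b)"
    "\<And>x. x \<in> U \<Longrightarrow> (f has_derivative D x) (at x)"
    "\<And>x b. x \<in> U \<Longrightarrow> b \<in> Basis \<Longrightarrow> D x b = G b x"
    by (rule Ck_up_to_SucE) (rule that)
  from Suc.prems(2) obtain D' G' where g: "continuous_on C g" "\<And>b. b \<in> Basis \<Longrightarrow> Ck_up_to k U C (G' b)"
    "\<And>x. x \<in> U \<Longrightarrow> (g has_derivative D' x) (at x)"
    "\<And>x b. x \<in> U \<Longrightarrow> b \<in> Basis \<Longrightarrow> D' x b = G' b x"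
    by (rule Ck_up_to_SucE) (rule that)
  \<comment> \<open>The Leibniz rule multiplies the undifferentiated \<open>f\<close> and
    \<open>g\<close> by partial derivatives of order \<open>k\<close>, so both are first lowered to
    that order.\<close>
  note low = Suc.prems[THEN Ck_up_to_decrease]
  show ?case
    by (rule Ck_up_to_SucI[where G = "\<lambda>b x. p (f x) (G' b x) + p (G b x) (g x)"
          and D = "\<lambda>x h. p (f x) (D' x h) + p (D x h) (g x)"])
      (use f g low Suc.IH in \<open>auto intro!: bounded_bilinear.continuous_on[OF assms]
         bounded_bilinear.FDERIV[OF assms] Ck_up_to_add\<close>)
qed

text \<open>The derivative of \<open>inverse (f x)\<close> contains \<open>inverse (f x)\<close>
  only undifferentiated, so its order \<open>k\<close>, given by the induction hypothesis, suffices
  for order \<open>Suc k\<close>.\<close>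

lemma Ck_up_to_inverse:
  fixes f :: "'a::euclidean_space \<Rightarrow> real"
  assumes "U \<subseteq> C" "\<And>x. x \<in> C \<Longrightarrow> f x \<noteq> 0"
  shows "Ck_up_to k U C f \<Longrightarrow> Ck_up_to k U C (\<lambda>x. inverse (f x))"
proof (induction k)
  case 0
  then show ?case using assms by (auto intro: continuous_intros)
next
  case (Suc k)
  from Suc.prems(1) obtain D G where f: "continuous_on C f" "\<And>b. b \<in> Basis \<Longrightarrow> Ck_up_to k U C (G b)"
    "\<And>x. x \<in> U \<Longrightarrow> (f has_derivative D x) (at x)"
    "\<And>x b. x \<in> U \<Longrightarrow> b \<in> Basis \<Longrightarrow> D x b = G b x"
    by (rule Ck_up_to_SucE) (rule that)
  have inv: "Ck_up_to k U C (\<lambda>x. inverse (f x))"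
    using Suc Ck_up_to_decrease by blast
  show ?case
  proof (rule Ck_up_to_SucI)
    show "continuous_on C (\<lambda>x. inverse (f x))"
      using f(1) assms(2) by (auto intro: continuous_on_inverse)
    show "Ck_up_to k U C (\<lambda>x. (-1) * (inverse (f x) * G b x * inverse (f x)))" if "b \<in> Basis" for b
      by (intro Ck_up_to_bilinear[OF bounded_bilinear_mult] Ck_up_to_const inv f(2) that)
    show "((\<lambda>x. inverse (f x)) has_derivative (\<lambda>h. - (inverse (f x) * D x h * inverse (f x)))) (at x)"
      if "x \<in> U" for x
      using Deriv.has_derivative_inverse[OF _ f(3)[OF that]] assms that by auto
  qed (use f(4) in simp)
qed

text \<open>The derivative of the composite in direction \<open>b\<close> is that of
  \<open>f\<close> in direction \<open>P b\<close>; the last assumption on \<open>P\<close> makes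
  this either zero or one of the partials supplied by the recursion. The intended \<open>P\<close>
  freezes time: it maps \<open>(t, x)\<close> to \<open>(0, x)\<close>.\<close>

lemma Ck_up_to_compose_linear:
  assumes P: "bounded_linear P" "P ` U \<subseteq> U" "P ` C \<subseteq> C" "P ` Basis \<subseteq> insert 0 Basis"
  shows "Ck_up_to k U C f \<Longrightarrow> Ck_up_to k U C (\<lambda>x. f (P x))"
proof (induction k arbitrary: f)
  case 0
  then show ?case
    using P linear_continuous_on[OF P(1), of C] by (auto intro: continuous_on_compose2)
next
  case (Suc k)
  from Suc.prems(1) obtain D G where f: "continuous_on C f" "\<And>b. b \<in> Basis \<Longrightarrow> Ck_up_to k U C (G b)"
    "\<And>x. x \<in> U \<Longrightarrow> (f has_derivative D x) (at x)"
    "\<And>x b. x \<in> U \<Longrightarrow> b \<in> Basis \<Longrightarrow> D x b = G b x"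
    by (rule Ck_up_to_SucE) (rule that)
  show ?case
  proof (rule Ck_up_to_SucI[where G = "\<lambda>b x. if P b = 0 then 0 else G (P b) (P x)"
          and D = "\<lambda>x h. D (P x) (P h)"])
    show "continuous_on C (\<lambda>x. f (P x))"
      using P f(1) linear_continuous_on[OF P(1), of C] by (auto intro: continuous_on_compose2)
    show "Ck_up_to k U C (\<lambda>x. if P b = 0 then 0 else G (P b) (P x))" if "b \<in> Basis" for b
      using that P(4) f(2) Suc.IH by (cases "P b = 0") (auto simp: Ck_up_to_const)
    fix x assume x: "x \<in> U"
    then have "P x \<in> U" using P(2) by auto
    then show "((\<lambda>x. f (P x)) has_derivative (\<lambda>h. D (P x) (P h))) (at x)"
      using diff_chain_at[OF bounded_linear_imp_has_derivative[OF P(1)] f(3)] by (simp add: o_def)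
    show "D (P x) (P b) = (if P b = 0 then 0 else G (P b) (P x))" if "b \<in> Basis" for b
      using that P(4) f(4) \<open>P x \<in> U\<close> linear_0[OF has_derivative_linear[OF f(3)]] by auto
  qed
qed

section \<open>Smoothness by iterated partials is \<open>C^k\<close> for every
  \<open>k\<close>\<close>

lemma iterated_partial_cong:
  assumes "open U" "\<And>x. x \<in> U \<Longrightarrow> f x = g x" "x \<in> U"
  shows "iterated_partial bs f x = iterated_partial bs g x"
  using assms(3)
proof (induction bs arbitrary: x)
  case (Cons b bs)
  have ev: "\<forall>\<^sub>F y in at x. iterated_partial bs f y = iterated_partial bs g y"
    using Cons assms(1) by (auto simp: eventually_at_topological)
  have "(iterated_partial bs f has_derivative D) (at x) \<longleftrightarrow>
      (iterated_partial bs g has_derivative D) (at x)" for D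
    using has_derivative_transform_eventually[OF _ ev Cons.IH[OF Cons.prems]]
      has_derivative_transform_eventually[of "iterated_partial bs g" D x UNIV "iterated_partial bs f"]
      ev Cons.IH[OF Cons.prems] by (auto simp: eq_commute)
  then show ?case by (simp add: frechet_derivative_def)
qed (use assms in simp)

lemma iterated_partial_append:
  "iterated_partial (bs @ cs) f = iterated_partial bs (iterated_partial cs f)"
  by (induction bs) auto

lemma differentiable_on_cong:
  assumes "f differentiable_on S" "\<And>x. x \<in> S \<Longrightarrow> g x = f x"
  shows "g differentiable_on S"
  using assms unfolding differentiable_on_def differentiable_def
  by (metis has_derivative_transform)

text \<open>\<open>G b\<close> is the continuous extension of the partial derivative in direction
  \<open>b\<close>. On the open set \<open>U\<close> its own partials are those of \<open>f\<close>
  of one order more, because derivatives depend only on values near the point; hence it is smooth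
  again.\<close>

lemma smooth_up_to_partial:
  fixes f :: "'a::euclidean_space \<Rightarrow> 'b::real_normed_vector"
  assumes U: "open U" and f: "smooth_up_to U C f"
  obtains G D where "\<And>b. b \<in> Basis \<Longrightarrow> smooth_up_to U C (G b)"
    and "\<And>x. x \<in> U \<Longrightarrow> (f has_derivative D x) (at x)"
    and "\<And>x b. x \<in> U \<Longrightarrow> b \<in> Basis \<Longrightarrow> D x b = G b x"
proof -
  have diff: "iterated_partial bs f differentiable_on U"
    and ext: "\<exists>g. continuous_on C g \<and> (\<forall>x\<in>U. g x = iterated_partial bs f x)"
    if "set bs \<subseteq> Basis" for bs
    using f that unfolding smooth_up_to_def lists_eq_set by blast+
  have "\<forall>b\<in>Basis. \<exists>g. continuous_on C g \<and> (\<forall>x\<in>U. g x = iterated_partial [b] f x)"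
    by (intro ballI ext) simp
  then obtain G where G: "\<forall>b\<in>Basis. continuous_on C (G b) \<and> (\<forall>x\<in>U. G b x = iterated_partial [b] f x)"
    by (rule bchoice[THEN exE])
  have eq: "iterated_partial bs (G b) x = iterated_partial (bs @ [b]) f x"
    if "b \<in> Basis" "x \<in> U" for bs b x
    unfolding iterated_partial_append using G that by (intro iterated_partial_cong[OF U]) auto
  show ?thesis
  proof (rule that)
    fix b :: 'a assume b: "b \<in> Basis"
    show "smooth_up_to U C (G b)"
      unfolding smooth_up_to_def
    proof (intro conjI ballI)
      show "continuous_on C (G b)"
        using G b by blast
      fix bs :: "'a list" assume bs: "bs \<in> lists Basis"
      then have *: "set (bs @ [b]) \<subseteq> Basis" using b by auto
      show "iterated_partial bs (G b) differentiable_on U"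
        using diff[OF *] eq[OF b] by (rule differentiable_on_cong) simp
      show "\<exists>g. continuous_on C g \<and> (\<forall>x\<in>U. g x = iterated_partial bs (G b) x)"
        using ext[OF *] eq[OF b] by simp
    qed
  next
    fix x assume x: "x \<in> U"
    have "f differentiable_on U"
      using diff[of "[]"] by simp
    then show "(f has_derivative frechet_derivative f (at x)) (at x)"
      using x U by (simp add: differentiable_on_eq_differentiable_at frechet_derivative_works)
    show "frechet_derivative f (at x) b = G b x" if "b \<in> Basis" for b
      using G that x by simp
  qed
qed

lemma smooth_up_to_imp_Ck_up_to:
  assumes "open U"
  shows "smooth_up_to U C f \<Longrightarrow> Ck_up_to k U C f"
proof (induction k arbitrary: f)
  case 0
  then show ?case by (simp add: smooth_up_to_def)
next
  case (Suc k)
  from assms Suc.prems obtain G D where "\<And>b. b \<in> Basis \<Longrightarrow> smooth_up_to U C (G b)"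
    "\<And>x. x \<in> U \<Longrightarrow> (f has_derivative D x) (at x)"
    "\<And>x b. x \<in> U \<Longrightarrow> b \<in> Basis \<Longrightarrow> D x b = G b x"
    by (rule smooth_up_to_partial) (rule that)
  moreover have "continuous_on C f"
    using Suc.prems by (simp add: smooth_up_to_def)
  ultimately show ?case
    by (intro Ck_up_to_SucI[where G = G and D = D] Suc.IH)
qed

text \<open>Each differentiation costs one order. The induction carries the extension
  \<open>g\<close>, since \<open>iterated_partial bs f\<close> is controlled on \<open>U\<close>
  only.\<close>

lemma Ck_up_to_iterated_partial:
  assumes "open U" "set bs \<subseteq> Basis"
  shows "Ck_up_to (length bs + k) U C f \<Longrightarrow> \<exists>g. Ck_up_to k U C g \<and> (\<forall>x\<in>U. g x = iterated_partial bs f x)"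
  using assms(2)
proof (induction bs arbitrary: k)
  case Nil
  then show ?case by auto
next
  case (Cons b bs)
  \<comment> \<open>Here \<open>length (b # bs) + k\<close> is read as
    \<open>length bs + Suc k\<close>, which reserves one order for the derivative in direction
    \<open>b\<close>.\<close>
  then have "\<exists>g. Ck_up_to (Suc k) U C g \<and> (\<forall>x\<in>U. g x = iterated_partial bs f x)"
    by (intro Cons.IH) (auto simp del: Ck_up_to.simps)
  then obtain g where g: "Ck_up_to (Suc k) U C g" "\<And>x. x \<in> U \<Longrightarrow> g x = iterated_partial bs f x"
    by blast
  from g(1) obtain G D where G: "continuous_on C g" "\<And>b. b \<in> Basis \<Longrightarrow> Ck_up_to k U C (G b)"
    and D: "\<And>x. x \<in> U \<Longrightarrow> (g has_derivative D x) (at x)"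
      "\<And>x b. x \<in> U \<Longrightarrow> b \<in> Basis \<Longrightarrow> D x b = G b x"
    by (rule Ck_up_to_SucE) (rule that)
  have "G b x = iterated_partial (b # bs) f x" if x: "x \<in> U" for x
  proof -
    have "iterated_partial (b # bs) f x = iterated_partial [b] g x"
      using iterated_partial_cong[OF assms(1) g(2)[symmetric] x, where bs = "[b]"]
        iterated_partial_append[of "[b]" bs f] by simp
    also have "\<dots> = D x b"
      using frechet_derivative_at[OF D(1)[OF x]] by simp
    finally show ?thesis using D(2) x Cons.prems by auto
  qed
  then show ?case using G(2) Cons.prems by auto
qed

lemma smooth_up_to_iff_Ck_up_to:
  assumes "open U"
  shows "smooth_up_to U C f \<longleftrightarrow> (\<forall>k. Ck_up_to k U C f)"
proof
  assume f: "\<forall>k. Ck_up_to k U C f"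
  show "smooth_up_to U C f"
    unfolding smooth_up_to_def
  proof (intro conjI ballI)
    show "continuous_on C f"
      using f Ck_up_to_continuous_on by blast
    fix bs :: "'a list" assume bs: "bs \<in> lists Basis"
    \<comment> \<open>Order one rather than zero: continuity yields the extension, the extra order
      yields differentiability on \<open>U\<close>.\<close>
    then have "\<exists>g. Ck_up_to (Suc 0) U C g \<and> (\<forall>x\<in>U. g x = iterated_partial bs f x)"
      using f by (intro Ck_up_to_iterated_partial assms) auto
    then obtain g where g: "Ck_up_to (Suc 0) U C g" "\<And>x. x \<in> U \<Longrightarrow> g x = iterated_partial bs f x"
      by blast
    then show "\<exists>g. continuous_on C g \<and> (\<forall>x\<in>U. g x = iterated_partial bs f x)"
      using Ck_up_to_continuous_on by blast
    from g(1) obtain G D where "continuous_on C g" "\<And>b. b \<in> Basis \<Longrightarrow> Ck_up_to 0 U C (G b)"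
      "\<And>x. x \<in> U \<Longrightarrow> (g has_derivative D x) (at x)"
      "\<And>x b. x \<in> U \<Longrightarrow> b \<in> Basis \<Longrightarrow> D x b = G b x"
      by (rule Ck_up_to_SucE) (rule that)
    then have "g differentiable_on U"
      by (meson differentiable_at_imp_differentiable_on differentiable_def)
    then show "iterated_partial bs f differentiable_on U"
      by (rule differentiable_on_cong) (simp add: g(2))
  qed
qed (simp add: assms smooth_up_to_imp_Ck_up_to)

section \<open>Derivatives at the boundary and under the integral sign\<close>

lemma continuous_on_closure_eq:
  fixes f g :: "'a::topological_space \<Rightarrow> 'b::real_normed_vector"
  assumes "continuous_on (closure S) f" "continuous_on (closure S) g"
    and "\<And>x. x \<in> S \<Longrightarrow> f x = g x" "x \<in> closure S"
  shows "f x = g x"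
  using continuous_constant_on_closure[of S "\<lambda>x. f x - g x" 0 x] assms
  by (simp add: continuous_on_diff)

text \<open>By the fundamental theorem of calculus, the derivative is equivalent to an integral
  identity, which is preserved under limits.\<close>

lemma has_vector_derivative_on_closure:
  fixes F G :: "real \<times> 'a::real_normed_vector \<Rightarrow> 'b::banach"
  assumes F: "continuous_on ({c<..<d} \<times> closure S) F" and G: "continuous_on ({c<..<d} \<times> closure S) G"
    and deriv: "\<And>t x. t \<in> {c<..<d} \<Longrightarrow> x \<in> S \<Longrightarrow> ((\<lambda>s. F (s, x)) has_vector_derivative G (t, x)) (at t)"
    and t: "t \<in> {c<..<d}" and x: "x \<in> closure S"
  shows "((\<lambda>s. F (s, x)) has_vector_derivative G (t, x)) (at t)"
proof -
  obtain a b where ab: "c < a" "a < t" "t < b" "b < d"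
    using t dense by (metis greaterThanLessThan_iff)
  have FTC: "F (s, y) = F (a, y) + integral {a..s} (\<lambda>r. G (r, y))"
    if s: "s \<in> {a..b}" and y: "y \<in> closure S" for s y
  \<comment> \<open>Both sides are continuous in \<open>y\<close> on the closure, the integral
    because \<open>G\<close> is jointly continuous, so only points of \<open>S\<close> remain to be
    checked.\<close>
  proof (rule continuous_on_closure_eq[OF _ _ _ y, where f = "\<lambda>y. F (s, y)"])
    have "s \<in> {c<..<d}" "a \<in> {c<..<d}"
      using s ab by auto
    then show "continuous_on (closure S) (\<lambda>y. F (s, y))"
      by (intro continuous_on_compose2[OF F]) (auto intro!: continuous_intros)
    have "continuous_on (closure S \<times> cbox a s) (\<lambda>(y, r). G (r, y))"
      unfolding split_beta using s ab by (intro continuous_on_compose2[OF G]) (auto intro!: continuous_intros)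
    from integral_continuous_on_param[OF this]
    have "continuous_on (closure S) (\<lambda>y. integral {a..s} (\<lambda>r. G (r, y)))"
      by simp
    moreover have "continuous_on (closure S) (\<lambda>y. F (a, y))"
      using \<open>a \<in> _\<close> by (intro continuous_on_compose2[OF F]) (auto intro!: continuous_intros)
    ultimately show "continuous_on (closure S) (\<lambda>y. F (a, y) + integral {a..s} (\<lambda>r. G (r, y)))"
      by (intro continuous_on_add)
    fix y assume "y \<in> S"
    have "((\<lambda>r. G (r, y)) has_integral F (s, y) - F (a, y)) {a..s}"
    proof (rule fundamental_theorem_of_calculus)
      show "((\<lambda>r. F (r, y)) has_vector_derivative G (r, y)) (at r within {a..s})"
        if "r \<in> {a..s}" for r
        using that s ab by (intro has_vector_derivative_at_within[OF deriv] \<open>y \<in> S\<close>) auto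
    qed (use s in simp)
    then show "F (s, y) = F (a, y) + integral {a..s} (\<lambda>r. G (r, y))"
      by (simp add: integral_unique)
  qed
  have "continuous_on {a..b} (\<lambda>r. G (r, x))"
    using ab x by (intro continuous_on_compose2[OF G]) (auto intro!: continuous_intros)
  then have "((\<lambda>s. F (a, x) + integral {a..s} (\<lambda>r. G (r, x))) has_vector_derivative G (t, x))
      (at t within {a..b})"
    using ab has_vector_derivative_add[OF has_vector_derivative_const integral_has_vector_derivative, of a b _ t "F (a, x)"]
    by simp
  then have "((\<lambda>s. F (s, x)) has_vector_derivative G (t, x)) (at t within {a..b})"
    using ab by (intro has_vector_derivative_transform[OF _ FTC]) (auto simp: x)
  then show ?thesis
    using ab at_within_Icc_at[of a t b] by simp
qed

section \<open>Integrals over a bounded open set and their derivatives in a parameter\<close>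

lemma set_integrable_continuous_on_closure:
  fixes f :: "'a::euclidean_space \<Rightarrow> real"
  assumes "open B" "bounded B" "continuous_on (closure B) f"
  shows "set_integrable lborel B f"
proof (rule set_integrable_subset)
  show "set_integrable lborel (closure B) f"
    unfolding set_integrable_def using assms by (intro borel_integrable_compact) auto
qed (use assms closure_subset in auto)

text \<open>Dominated convergence for the difference quotients along an arbitrary sequence tending
  to \<open>t\<close>. By the mean value inequality they are bounded by the maximum of
  \<open>h'\<close> over the compact set \<open>{a..b} \<times> closure B\<close>.\<close>

lemma has_real_derivative_set_integral:
  fixes h h' :: "real \<times> 'a::euclidean_space \<Rightarrow> real"
  assumes B: "open B" "bounded B"
    and h: "continuous_on ({c<..<d} \<times> closure B) h"
    and h': "continuous_on ({c<..<d} \<times> closure B) h'"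
    and deriv: "\<And>t x. t \<in> {c<..<d} \<Longrightarrow> x \<in> B \<Longrightarrow> ((\<lambda>s. h (s, x)) has_real_derivative h' (t, x)) (at t)"
    and t: "t \<in> {c<..<d}"
  shows "((\<lambda>t. LINT x:B|lborel. h (t, x)) has_real_derivative (LINT x:B|lborel. h' (t, x))) (at t)"
proof -
  obtain a b where ab: "c < a" "a < t" "t < b" "b < d"
    using t dense by (metis greaterThanLessThan_iff)
  have cont: "continuous_on (closure B) (\<lambda>x. g (s, x))"
    if "continuous_on ({c<..<d} \<times> closure B) g" "s \<in> {c<..<d}" for s and g :: "_ \<Rightarrow> real"
    using that(2) by (intro continuous_on_compose2[OF that(1)]) (auto intro!: continuous_intros)
  note int = set_integrable_continuous_on_closure[OF B cont]
  have "compact (h' ` ({a..b} \<times> closure B))"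
    using ab B by (intro compact_continuous_image continuous_on_subset[OF h'] compact_Times) auto
  then obtain M where M: "\<And>s x. s \<in> {a..b} \<Longrightarrow> x \<in> closure B \<Longrightarrow> \<bar>h' (s, x)\<bar> \<le> M"
    by (force dest!: compact_imp_bounded simp: bounded_iff)
  have "((\<lambda>s. ((LINT x:B|lborel. h (s, x)) - (LINT x:B|lborel. h (t, x))) / (s - t))
      \<longlongrightarrow> (LINT x:B|lborel. h' (t, x))) (at t)"
    unfolding tendsto_at_iff_sequentially comp_def
  proof (intro allI impI)
    fix X assume X: "\<forall>i. X i \<in> UNIV - {t}" "X \<longlonglongrightarrow> t"
    have "\<forall>\<^sub>F i in sequentially. X i \<in> {a<..<b}"
      using X(2) ab by (intro topological_tendstoD) auto
    \<comment> \<open>Dropping the first \<open>k\<close> terms puts the whole sequence into the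
      interval on which the bound \<open>M\<close> is valid.\<close>
    then obtain k where k: "\<And>i. X (i + k) \<in> {a<..<b}"
      by (auto simp: eventually_sequentially) (metis le_add2)
    define Y where "Y i = X (i + k)" for i
    have Y: "Y i \<in> {a<..<b}" "Y i \<noteq> t" for i
      using k X by (auto simp: Y_def)
    have Yt: "Y \<longlonglongrightarrow> t"
      unfolding Y_def using X(2) by (rule LIMSEQ_ignore_initial_segment)
    define q where "q i x = (h (Y i, x) - h (t, x)) / (Y i - t)" for i x
    have q_int: "set_integrable lborel B (q i)" for i
      unfolding q_def using Y[of i] ab t
      by (intro set_integrable_divide set_integral_diff int h) auto
    have q_eq: "(LINT x:B|lborel. q i x) =
        ((LINT x:B|lborel. h (Y i, x)) - (LINT x:B|lborel. h (t, x))) / (Y i - t)" for i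
      unfolding q_def using Y[of i] ab t
      by (subst set_integral_divide_zero) (auto simp: set_integral_diff int h)
    have lim: "(\<lambda>i. q i x) \<longlonglongrightarrow> h' (t, x)" if "x \<in> B" for x
      using deriv[OF t that] Y(2) Yt
      unfolding has_field_derivative_iff tendsto_at_iff_sequentially comp_def q_def by auto
    have bound: "\<bar>q i x\<bar> \<le> M" if x: "x \<in> B" for i x
    proof -
      have "norm (h (Y i, x) - h (t, x)) \<le> M * norm (Y i - t)"
      proof (rule field_differentiable_bound[of "{a..b}" _ "\<lambda>s. h' (s, x)"])
        fix s assume s: "s \<in> {a..b}"
        then have "s \<in> {c<..<d}"
          using ab by simp
        from deriv[OF this x] show "((\<lambda>s. h (s, x)) has_real_derivative h' (s, x)) (at s within {a..b})"
          by (rule has_field_derivative_at_within)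
        show "norm (h' (s, x)) \<le> M"
          using M[OF s] x closure_subset[of B] by auto
      qed (use ab Y[of i] in auto)
      then show ?thesis
        using Y[of i] by (simp add: q_def divide_le_eq)
    qed
    have "(\<lambda>i. LINT x:B|lborel. q i x) \<longlonglongrightarrow> (LINT x:B|lborel. h' (t, x))"
      unfolding set_lebesgue_integral_def
    proof (rule integral_dominated_convergence)
      show "integrable lborel (\<lambda>x. indicator B x *\<^sub>R M)"
        using set_integrable_continuous_on_closure[OF B, of "\<lambda>_. M"]
        by (simp add: set_integrable_def)
      show "(\<lambda>x. indicat_real B x *\<^sub>R h' (t, x)) \<in> borel_measurable lborel"
        using int[OF h' t] unfolding set_integrable_def by (rule borel_measurable_integrable)
      show "(\<lambda>x. indicat_real B x *\<^sub>R q i x) \<in> borel_measurable lborel" for i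
        using q_int unfolding set_integrable_def by (rule borel_measurable_integrable)
    qed (auto intro!: AE_I2 lim bound split: split_indicator)
    then show "(\<lambda>i. ((LINT x:B|lborel. h (X i, x)) - (LINT x:B|lborel. h (t, x))) / (X i - t))
        \<longlonglongrightarrow> (LINT x:B|lborel. h' (t, x))"
      unfolding q_eq Y_def by (rule LIMSEQ_offset)
  qed
  then show ?thesis
    by (simp add: has_field_derivative_iff)
qed

text \<open>The integrands in question contain \<open>nabla\<close> and are controlled only on
  \<open>B\<close>. The continuous \<open>H\<close> and \<open>H'\<close> provide the bounds, while
  the integrals over \<open>B\<close> do not see the difference.\<close>

lemma has_real_derivative_set_integral_extension:
  fixes h h' :: "real \<Rightarrow> 'a::euclidean_space \<Rightarrow> real" and H H' :: "real \<times> 'a \<Rightarrow> real"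
  assumes B: "open B" "bounded B"
    and H: "continuous_on ({c<..<d} \<times> closure B) H"
      "\<And>t x. t \<in> {c<..<d} \<Longrightarrow> x \<in> B \<Longrightarrow> h t x = H (t, x)"
    and H': "continuous_on ({c<..<d} \<times> closure B) H'"
      "\<And>t x. t \<in> {c<..<d} \<Longrightarrow> x \<in> B \<Longrightarrow> h' t x = H' (t, x)"
    and deriv: "\<And>t x. t \<in> {c<..<d} \<Longrightarrow> x \<in> B \<Longrightarrow> ((\<lambda>s. h s x) has_real_derivative h' t x) (at t)"
    and t: "t \<in> {c<..<d}"
  shows "((\<lambda>t. LINT x:B|lborel. h t x) has_real_derivative (LINT x:B|lborel. h' t x)) (at t)"
proof -
  have eq: "(LINT x:B|lborel. H (s, x)) = (LINT x:B|lborel. h s x)"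
    "(LINT x:B|lborel. H' (s, x)) = (LINT x:B|lborel. h' s x)" if "s \<in> {c<..<d}" for s
    using B H(2)[OF that] H'(2)[OF that] by (auto intro!: set_lebesgue_integral_cong)
  have "((\<lambda>s. H (s, x)) has_real_derivative H' (t, x)) (at t)" if "t \<in> {c<..<d}" "x \<in> B" for t x
    using has_field_derivative_transform_within_open[OF deriv[OF that] _ that(1)] H(2) H'(2) that by simp
  from has_real_derivative_set_integral[OF B H(1) H'(1) this t]
  have "((\<lambda>t. LINT x:B|lborel. H (t, x)) has_real_derivative (LINT x:B|lborel. h' t x)) (at t)"
    using eq(2)[OF t] by simp
  then show ?thesis
    by (rule has_field_derivative_transform_within_open[OF _ _ t]) (auto simp: eq)
qed

lemma set_integrable_extension:
  fixes f g :: "'a::euclidean_space \<Rightarrow> real"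
  assumes B: "open B" "bounded B" and g: "continuous_on (closure B) g" "\<And>x. x \<in> B \<Longrightarrow> f x = g x"
  shows "set_integrable lborel B f"
proof -
  have "set_integrable lborel B f \<longleftrightarrow> set_integrable lborel B g"
    by (rule set_integrable_cong) (auto simp: g(2))
  then show ?thesis
    using set_integrable_continuous_on_closure[OF B g(1)] by simp
qed

section \<open>Smooth time-dependent fields\<close>

abbreviation smooth_on_cylinder ::
    "real \<Rightarrow> real \<Rightarrow> 'a::euclidean_space set \<Rightarrow> (real \<times> 'a \<Rightarrow> 'b::real_normed_vector) \<Rightarrow> bool" where
  "smooth_on_cylinder c d B \<equiv> smooth_up_to ({c<..<d} \<times> B) ({c<..<d} \<times> closure B)"

text \<open>The basis of the product space consists of \<open>(1, 0)\<close> and the vectors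
  \<open>(0, b)\<close>: the partial in the first direction is the time derivative \<open>V\<close>,
  those in the others are the spatial \<open>P b\<close>.\<close>

lemma smooth_up_to_cross_section:
  fixes F :: "real \<times> 'a::euclidean_space \<Rightarrow> 'b::real_normed_vector"
  assumes B: "open B" and F: "smooth_on_cylinder c d B F"
  obtains V P D where "smooth_on_cylinder c d B V"
    and "\<And>t x. t \<in> {c<..<d} \<Longrightarrow> x \<in> B \<Longrightarrow> ((\<lambda>s. F (s, x)) has_vector_derivative V (t, x)) (at t)"
    and "\<And>b. b \<in> Basis \<Longrightarrow> smooth_on_cylinder c d B (P b)"
    and "\<And>t x. t \<in> {c<..<d} \<Longrightarrow> x \<in> B \<Longrightarrow> ((\<lambda>y. F (t, y)) has_derivative D t x) (at x)"
    and "\<And>t x b. t \<in> {c<..<d} \<Longrightarrow> x \<in> B \<Longrightarrow> b \<in> Basis \<Longrightarrow> D t x b = P b (t, x)"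
proof -
  have U: "open ({c<..<d} \<times> B)"
    using B by (intro open_Times) auto
  from U F obtain G D where G: "\<And>b. b \<in> Basis \<Longrightarrow> smooth_on_cylinder c d B (G b)"
    and D: "\<And>x. x \<in> {c<..<d} \<times> B \<Longrightarrow> (F has_derivative D x) (at x)"
    and DG: "\<And>x b. x \<in> {c<..<d} \<times> B \<Longrightarrow> b \<in> Basis \<Longrightarrow> D x b = G b x"
    by (rule smooth_up_to_partial) (rule that)
  show ?thesis
  proof (rule that[of "G (1, 0)" "\<lambda>b. G (0, b)" "\<lambda>t x h. D (t, x) (0, h)"])
    show "smooth_on_cylinder c d B (G (1, 0))"
      by (rule G) (simp add: Basis_prod_def)
    show "smooth_on_cylinder c d B (G (0, b))" if "b \<in> Basis" for b
      using that by (intro G) (simp add: Basis_prod_def)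
    fix t x assume tx: "t \<in> {c<..<d}" "x \<in> B"
    then have tx': "(t, x) \<in> {c<..<d} \<times> B" by simp
    show "D (t, x) (0, b) = G (0, b) (t, x)" if "b \<in> Basis" for b
      using that by (intro DG tx') (simp add: Basis_prod_def)
    show "((\<lambda>y. F (t, y)) has_derivative (\<lambda>h. D (t, x) (0, h))) (at x)"
      using diff_chain_at[OF has_derivative_Pair[OF has_derivative_const has_derivative_ident] D[OF tx']]
      by (simp add: o_def)
    have "((\<lambda>s. F (s, x)) has_derivative (\<lambda>h. D (t, x) (h, 0))) (at t)"
      using diff_chain_at[OF has_derivative_Pair[OF has_derivative_ident has_derivative_const] D[OF tx']]
      by (simp add: o_def)
    moreover have "D (t, x) (h, 0) = h *\<^sub>R G (1, 0) (t, x)" for h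
    proof -
      have "D (t, x) (h *\<^sub>R (1, 0)) = h *\<^sub>R D (t, x) (1, 0)"
        by (rule linear_cmul[OF has_derivative_linear[OF D[OF tx']]])
      moreover have "D (t, x) (1, 0) = G (1, 0) (t, x)"
        by (intro DG tx') (simp add: Basis_prod_def)
      ultimately show ?thesis by simp
    qed
    ultimately show "((\<lambda>s. F (s, x)) has_vector_derivative G (1, 0) (t, x)) (at t)"
      by (simp add: has_vector_derivative_def)
  qed
qed

text \<open>The time derivative is valid on the whole closure, as the claims about velocity and
  acceleration require. Since \<open>V\<close> is smooth again, a second application yields the
  acceleration.\<close>

lemma smooth_up_to_time_derivative:
  fixes F :: "real \<times> 'a::euclidean_space \<Rightarrow> 'b::banach"
  assumes B: "open B" and F: "smooth_on_cylinder c d B F"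
  obtains V where "smooth_on_cylinder c d B V"
    and "\<And>t x. t \<in> {c<..<d} \<Longrightarrow> x \<in> closure B \<Longrightarrow>
      ((\<lambda>s. F (s, x)) has_vector_derivative V (t, x)) (at t)"
proof -
  from B F obtain V P D where V: "smooth_on_cylinder c d B V"
    and deriv: "\<And>t x. t \<in> {c<..<d} \<Longrightarrow> x \<in> B \<Longrightarrow> ((\<lambda>s. F (s, x)) has_vector_derivative V (t, x)) (at t)"
    and "\<And>b. b \<in> Basis \<Longrightarrow> smooth_on_cylinder c d B (P b)"
    and "\<And>t x. t \<in> {c<..<d} \<Longrightarrow> x \<in> B \<Longrightarrow> ((\<lambda>y. F (t, y)) has_derivative D t x) (at x)"
    and "\<And>t x b. t \<in> {c<..<d} \<Longrightarrow> x \<in> B \<Longrightarrow> b \<in> Basis \<Longrightarrow> D t x b = P b (t, x)"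
    by (rule smooth_up_to_cross_section) (rule that)
  show ?thesis
  proof (rule that[OF V])
    fix t x assume "t \<in> {c<..<d}" "x \<in> closure B"
    with F V deriv show "((\<lambda>s. F (s, x)) has_vector_derivative V (t, x)) (at t)"
      unfolding smooth_up_to_def by (intro has_vector_derivative_on_closure[of c d B F V t x]) auto
  qed
qed

text \<open>Both sides of \<open>F (s, y) - F (a, y) = \<integral>\<^bsub>a\<^esub>\<^bsup>s\<^esup> V (r, y) dr\<close> are differentiated in
  direction \<open>b\<close> and then in \<open>s\<close>.\<close>

lemma mixed_partials_commute:
  fixes F V F' V' :: "real \<times> 'a::real_normed_vector \<Rightarrow> 'b::banach"
  assumes B: "open B"
    and F_t: "\<And>t x. t \<in> {c<..<d} \<Longrightarrow> x \<in> B \<Longrightarrow> ((\<lambda>s. F (s, x)) has_vector_derivative V (t, x)) (at t)"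
    and F_b: "\<And>t x r. t \<in> {c<..<d} \<Longrightarrow> x + r *\<^sub>R b \<in> B \<Longrightarrow>
      ((\<lambda>r. F (t, x + r *\<^sub>R b)) has_vector_derivative F' (t, x + r *\<^sub>R b)) (at r)"
    and V_b: "\<And>t x r. t \<in> {c<..<d} \<Longrightarrow> x + r *\<^sub>R b \<in> B \<Longrightarrow>
      ((\<lambda>r. V (t, x + r *\<^sub>R b)) has_vector_derivative V' (t, x + r *\<^sub>R b)) (at r)"
    and V: "continuous_on ({c<..<d} \<times> B) V" and V': "continuous_on ({c<..<d} \<times> B) V'"
    and t: "t \<in> {c<..<d}" and x: "x \<in> B"
  shows "((\<lambda>s. F' (s, x)) has_vector_derivative V' (t, x)) (at t)"
proof -
  obtain a a' where a: "c < a" "a < t" "t < a'" "a' < d"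
    using t dense by (metis greaterThanLessThan_iff)
  have "((\<lambda>r. x + r *\<^sub>R b) \<longlongrightarrow> x + 0 *\<^sub>R b) (at 0)"
    by (intro tendsto_intros)
  then have "\<forall>\<^sub>F r in at 0. x + r *\<^sub>R b \<in> B"
    using B x by (intro topological_tendstoD) auto
  then obtain \<delta> where "\<delta> > 0" and \<delta>': "\<forall>r. r \<noteq> 0 \<and> dist r 0 < \<delta> \<longrightarrow> x + r *\<^sub>R b \<in> B"
    unfolding eventually_at by blast
  have \<delta>: "x + r *\<^sub>R b \<in> B" if "r \<in> {-\<delta><..<\<delta>}" for r
    using \<delta>'[rule_format, of r] x that by (cases "r = 0") (auto simp: abs_less_iff)
  have FTC: "F' (s, x) = F' (a, x) + integral {a..s} (\<lambda>r. V' (r, x))" if s: "s \<in> {a..a'}" for s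
  proof -
    have int: "((\<lambda>q. V (q, x + r *\<^sub>R b)) has_integral F (s, x + r *\<^sub>R b) - F (a, x + r *\<^sub>R b)) {a..s}"
      if "r \<in> {-\<delta><..<\<delta>}" for r
    proof (rule fundamental_theorem_of_calculus)
      fix q assume "q \<in> {a..s}"
      then show "((\<lambda>q. F (q, x + r *\<^sub>R b)) has_vector_derivative V (q, x + r *\<^sub>R b)) (at q within {a..s})"
        using s a \<delta>[OF that] by (intro has_vector_derivative_at_within[OF F_t]) auto
    qed (use s in simp)
    have "((\<lambda>r. integral (cbox a s) (\<lambda>q. V (q, x + r *\<^sub>R b))) has_vector_derivative
        integral (cbox a s) (\<lambda>q. V' (q, x + 0 *\<^sub>R b))) (at 0 within {-\<delta><..<\<delta>})"
    proof (rule leibniz_rule_vector_derivative)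
      fix r q assume "r \<in> {-\<delta><..<\<delta>}" "q \<in> cbox a s"
      then show "((\<lambda>r. V (q, x + r *\<^sub>R b)) has_vector_derivative V' (q, x + r *\<^sub>R b)) (at r within {-\<delta><..<\<delta>})"
        using s a \<delta> by (intro has_vector_derivative_at_within[OF V_b]) auto
    next
      show "continuous_on ({-\<delta><..<\<delta>} \<times> cbox a s) (\<lambda>(r, q). V' (q, x + r *\<^sub>R b))"
        unfolding split_beta using s a \<delta>
        by (intro continuous_on_compose2[OF V']) (auto intro!: continuous_intros)
    qed (use int \<open>\<delta> > 0\<close> in auto)
    then have "((\<lambda>r. integral (cbox a s) (\<lambda>q. V (q, x + r *\<^sub>R b))) has_vector_derivative
        integral (cbox a s) (\<lambda>q. V' (q, x + 0 *\<^sub>R b))) (at 0)"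
      by (rule has_vector_derivative_within_open[THEN iffD1, rotated 2]) (use \<open>\<delta> > 0\<close> in auto)
    then have "((\<lambda>r. integral {a..s} (\<lambda>q. V (q, x + r *\<^sub>R b))) has_vector_derivative
        integral {a..s} (\<lambda>q. V' (q, x))) (at 0)"
      by simp
    \<comment> \<open>The same function of \<open>r\<close> is a difference of two values of
      \<open>F\<close>, whose derivative in direction \<open>b\<close> is known directly; uniqueness
      of derivatives then identifies the two expressions.\<close>
    moreover have "((\<lambda>r. integral {a..s} (\<lambda>q. V (q, x + r *\<^sub>R b))) has_vector_derivative
        F' (s, x + 0 *\<^sub>R b) - F' (a, x + 0 *\<^sub>R b)) (at 0)"
    proof (rule has_vector_derivative_transform_within_open)
      show "((\<lambda>r. F (s, x + r *\<^sub>R b) - F (a, x + r *\<^sub>R b)) has_vector_derivative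
          F' (s, x + 0 *\<^sub>R b) - F' (a, x + 0 *\<^sub>R b)) (at 0)"
        using s a x by (intro has_vector_derivative_diff F_b) auto
      show "F (s, x + r *\<^sub>R b) - F (a, x + r *\<^sub>R b) = integral {a..s} (\<lambda>q. V (q, x + r *\<^sub>R b))"
        if "r \<in> {-\<delta><..<\<delta>}" for r
        using int[OF that] by (rule integral_unique[symmetric])
    qed (use \<open>\<delta> > 0\<close> in auto)
    ultimately have "integral {a..s} (\<lambda>q. V' (q, x)) = F' (s, x + 0 *\<^sub>R b) - F' (a, x + 0 *\<^sub>R b)"
      by (rule vector_derivative_unique_at)
    then show ?thesis
      by simp
  qed
  have "continuous_on {a..a'} (\<lambda>r. V' (r, x))"
    using a x by (intro continuous_on_compose2[OF V']) (auto intro!: continuous_intros)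
  then have "((\<lambda>s. F' (a, x) + integral {a..s} (\<lambda>r. V' (r, x))) has_vector_derivative V' (t, x))
      (at t within {a..a'})"
    using a has_vector_derivative_add[OF has_vector_derivative_const integral_has_vector_derivative, of a a' _ t "F' (a, x)"]
    by simp
  then have "((\<lambda>s. F' (s, x)) has_vector_derivative V' (t, x)) (at t within {a..a'})"
    using a by (intro has_vector_derivative_transform[OF _ FTC]) auto
  then show ?thesis
    using a at_within_Icc_at[of a t a'] by simp
qed

section \<open>Gradients of time-dependent fields\<close>

lemma has_vector_derivative_vec_lambda:
  fixes f :: "real \<Rightarrow> 'i::finite \<Rightarrow> 'b::real_normed_vector"
  assumes "\<And>i. ((\<lambda>s. f s i) has_vector_derivative f' i) (at t within S)"
  shows "((\<lambda>s. \<chi> i. f s i) has_vector_derivative (\<chi> i. f' i)) (at t within S)"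
  unfolding has_vector_derivative_def has_derivative_within
proof (intro conjI bounded_linear_scaleR_left vec_tendstoI)
  fix i
  show "((\<lambda>s. ((1 / norm (s - t)) *\<^sub>R ((\<chi> i. f s i) - ((\<chi> i. f t i) + (s - t) *\<^sub>R (\<chi> i. f' i)))) $ i)
      \<longlongrightarrow> 0 $ i) (at t within S)"
    using assms[of i] by (simp add: has_vector_derivative_def has_derivative_within)
qed

lemma nabla_eq:
  assumes "(u has_derivative D) (at x)"
  shows "nabla u x = (\<chi> i j. D (axis j 1) $ i)"
  using frechet_derivative_at[OF assms] by (simp add: nabla_def jacobian_def matrix_def)

lemma nabla_works:
  assumes "u differentiable (at x)"
  shows "(u has_derivative (\<lambda>h. nabla u x *v h)) (at x)"
  using assms by (simp add: nabla_def jacobian_works)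

text \<open>\<open>M\<close> is assembled from the continuous extensions of the spatial partials, so
  it is defined and continuous at boundary points, where \<open>nabla\<close> is not
  controlled.\<close>

lemma smooth_up_to_nabla:
  fixes F :: "real \<times> (real^3) \<Rightarrow> real^3"
  assumes B: "open B" and F: "smooth_on_cylinder c d B F"
  obtains M where "continuous_on ({c<..<d} \<times> closure B) M"
    and "\<And>t x. t \<in> {c<..<d} \<Longrightarrow> x \<in> B \<Longrightarrow> M (t, x) = nabla (\<lambda>y. F (t, y)) x"
proof -
  from B F obtain V P D where "smooth_on_cylinder c d B V"
    and "\<And>t x. t \<in> {c<..<d} \<Longrightarrow> x \<in> B \<Longrightarrow> ((\<lambda>s. F (s, x)) has_vector_derivative V (t, x)) (at t)"
    and P: "\<And>b. b \<in> Basis \<Longrightarrow> smooth_on_cylinder c d B (P b)"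
    and D: "\<And>t x. t \<in> {c<..<d} \<Longrightarrow> x \<in> B \<Longrightarrow> ((\<lambda>y. F (t, y)) has_derivative D t x) (at x)"
    and DP: "\<And>t x b. t \<in> {c<..<d} \<Longrightarrow> x \<in> B \<Longrightarrow> b \<in> Basis \<Longrightarrow> D t x b = P b (t, x)"
    by (rule smooth_up_to_cross_section) (rule that)
  show ?thesis
  proof (rule that[of "\<lambda>z. \<chi> i j. P (axis j 1) z $ i"])
    show "continuous_on ({c<..<d} \<times> closure B) (\<lambda>z. \<chi> i j. P (axis j 1) z $ i)"
      using P by (intro continuous_on_vec_lambda continuous_on_component)
        (auto simp: smooth_up_to_def)
    show "(\<chi> i j. P (axis j 1) (t, x) $ i) = nabla (\<lambda>y. F (t, y)) x"
      if "t \<in> {c<..<d}" "x \<in> B" for t x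
      using nabla_eq[OF D[OF that]] DP[OF that] by simp
  qed
qed

text \<open>The columns of \<open>nabla\<close> are the derivatives along the coordinate axes, so
  this is \<open>mixed_partials_commute\<close> column by column.\<close>

lemma nabla_time_derivative:
  fixes F V :: "real \<times> (real^3) \<Rightarrow> real^3"
  assumes B: "open B"
    and F: "smooth_on_cylinder c d B F"
    and V: "smooth_on_cylinder c d B V"
    and deriv: "\<And>t x. t \<in> {c<..<d} \<Longrightarrow> x \<in> B \<Longrightarrow> ((\<lambda>s. F (s, x)) has_vector_derivative V (t, x)) (at t)"
    and t: "t \<in> {c<..<d}" and x: "x \<in> B"
  shows "((\<lambda>s. nabla (\<lambda>y. F (s, y)) x) has_vector_derivative nabla (\<lambda>y. V (t, y)) x) (at t)"
proof -
  from B F obtain V0 P D where "smooth_on_cylinder c d B V0"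
    and "\<And>t x. t \<in> {c<..<d} \<Longrightarrow> x \<in> B \<Longrightarrow> ((\<lambda>s. F (s, x)) has_vector_derivative V0 (t, x)) (at t)"
    and P: "\<And>b. b \<in> Basis \<Longrightarrow> smooth_on_cylinder c d B (P b)"
    and D: "\<And>t x. t \<in> {c<..<d} \<Longrightarrow> x \<in> B \<Longrightarrow> ((\<lambda>y. F (t, y)) has_derivative D t x) (at x)"
    and DP: "\<And>t x b. t \<in> {c<..<d} \<Longrightarrow> x \<in> B \<Longrightarrow> b \<in> Basis \<Longrightarrow> D t x b = P b (t, x)"
    by (rule smooth_up_to_cross_section) (rule that)
  from B V obtain V1 Q E where "smooth_on_cylinder c d B V1"
    and "\<And>t x. t \<in> {c<..<d} \<Longrightarrow> x \<in> B \<Longrightarrow> ((\<lambda>s. V (s, x)) has_vector_derivative V1 (t, x)) (at t)"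
    and Q: "\<And>b. b \<in> Basis \<Longrightarrow> smooth_on_cylinder c d B (Q b)"
    and E: "\<And>t x. t \<in> {c<..<d} \<Longrightarrow> x \<in> B \<Longrightarrow> ((\<lambda>y. V (t, y)) has_derivative E t x) (at x)"
    and EQ: "\<And>t x b. t \<in> {c<..<d} \<Longrightarrow> x \<in> B \<Longrightarrow> b \<in> Basis \<Longrightarrow> E t x b = Q b (t, x)"
    by (rule smooth_up_to_cross_section) (rule that)
  have line: "((\<lambda>r. f (x + r *\<^sub>R b)) has_vector_derivative A b) (at r)"
    if "(f has_derivative A) (at (x + r *\<^sub>R b))" for f :: "real^3 \<Rightarrow> real^3" and A x r b
  proof -
    have "((\<lambda>r. x + r *\<^sub>R b) has_derivative (\<lambda>h. h *\<^sub>R b)) (at r)"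
      by (auto intro!: derivative_eq_intros)
    from diff_chain_at[OF this that] show ?thesis
      by (simp add: o_def has_vector_derivative_def linear_cmul[OF has_derivative_linear[OF that]])
  qed
  have cont: "continuous_on ({c<..<d} \<times> B) g"
    if "smooth_on_cylinder c d B g" for g :: "_ \<Rightarrow> real^3"
    using that closure_subset unfolding smooth_up_to_def
    by (meson Sigma_mono continuous_on_subset order_refl)
  have PQ: "((\<lambda>s. P b (s, x)) has_vector_derivative Q b (t, x)) (at t)" if b: "b \<in> Basis" for b
  proof (rule mixed_partials_commute[OF B deriv, of c d])
    show "((\<lambda>r. F (t, x + r *\<^sub>R b)) has_vector_derivative P b (t, x + r *\<^sub>R b)) (at r)"
      if "t \<in> {c<..<d}" "x + r *\<^sub>R b \<in> B" for t x r
      using line[OF D[OF that]] DP[OF that b] by simp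
    show "((\<lambda>r. V (t, x + r *\<^sub>R b)) has_vector_derivative Q b (t, x + r *\<^sub>R b)) (at r)"
      if "t \<in> {c<..<d}" "x + r *\<^sub>R b \<in> B" for t x r
      using line[OF E[OF that]] EQ[OF that b] by simp
  qed (use t x cont V Q[OF b] in auto)
  have "((\<lambda>s. \<chi> i j. P (axis j 1) (s, x) $ i) has_vector_derivative (\<chi> i j. Q (axis j 1) (t, x) $ i)) (at t)"
    by (intro has_vector_derivative_vec_lambda bounded_linear.has_vector_derivative[OF bounded_linear_vec_nth] PQ) simp
  moreover have "nabla (\<lambda>y. V (t, y)) x = (\<chi> i j. Q (axis j 1) (t, x) $ i)"
    using nabla_eq[OF E[OF t x]] EQ[OF t x] by simp
  moreover have "nabla (\<lambda>y. F (s, y)) x = (\<chi> i j. P (axis j 1) (s, x) $ i)" if "s \<in> {c<..<d}" for s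
    using nabla_eq[OF D[OF that x]] DP[OF that x] by simp
  ultimately show ?thesis
    using t by (auto intro: has_vector_derivative_transform_within_open[where S = "{c<..<d}"])
qed

section \<open>Frank's density as a function of the field and its gradient\<close>

text \<open>On \<open>real^'n\<close> the product is componentwise; doubled vectors arising in
  simplification are put into the scalar form that inner and cross products understand.\<close>

lemma two_mult_vec: "2 * x = 2 *\<^sub>R x" for x :: "real^'n"
  by (simp only: mult_2 scaleR_2)

text \<open>Twice the axial vector of the skew part of \<open>M\<close>. Being linear in the
  gradient, the curl can be differentiated in time without returning to space derivatives.\<close>

definition curl_matrix :: "real^3^3 \<Rightarrow> real^3" where
  "curl_matrix M = vector [M $ 3 $ 2 - M $ 2 $ 3, M $ 1 $ 3 - M $ 3 $ 1, M $ 2 $ 1 - M $ 1 $ 2]"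

lemma curl_eq: "curl u x = curl_matrix (nabla u x)"
  by (simp add: curl_def curl_matrix_def)

lemma bounded_linear_curl_matrix: "bounded_linear curl_matrix"
  unfolding linear_conv_bounded_linear[symmetric]
  by (rule linearI) (simp_all add: curl_matrix_def vec_eq_iff forall_3 algebra_simps)

lemma bounded_linear_trace: "bounded_linear (trace :: real^'n^'n \<Rightarrow> real)"
  unfolding linear_conv_bounded_linear[symmetric]
  by (rule linearI) (simp_all add: trace_def sum.distrib sum_distrib_left)

lemma bounded_bilinear_cross3: "bounded_bilinear cross3"
  using bilinear_cross bilinear_conv_bounded_bilinear by blast

lemma bounded_bilinear_matrix_mult:
  "bounded_bilinear ((**) :: real^'n^'m \<Rightarrow> real^'k^'n \<Rightarrow> real^'k^'m)"
  unfolding bilinear_conv_bounded_bilinear[symmetric] bilinear_def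
  by (auto intro!: linearI simp: vec_eq_iff matrix_matrix_mult_def algebra_simps sum.distrib sum_distrib_left)

definition frank_form ::
    "real \<Rightarrow> real \<Rightarrow> real \<Rightarrow> real \<Rightarrow> real^3 \<Rightarrow> real^3^3 \<Rightarrow> real" where
  "frank_form K11 K22 K33 K24 n M =
     1/2 * K11 * (trace M)\<^sup>2
     + 1/2 * K22 * (n \<bullet> curl_matrix M)\<^sup>2
     + 1/2 * K33 * (norm (cross3 n (curl_matrix M)))\<^sup>2
     + K24 * (trace (M ** M) - (trace M)\<^sup>2)"

text \<open>The differential of \<open>frank_form\<close> at \<open>(n, M)\<close> in the direction
  \<open>(n1, M1)\<close>. The factor 2 at \<open>trace (M ** M1)\<close> merges two products that
  have equal trace.\<close>

definition frank_form' ::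
    "real \<Rightarrow> real \<Rightarrow> real \<Rightarrow> real \<Rightarrow> real^3 \<Rightarrow> real^3^3 \<Rightarrow> real^3 \<Rightarrow> real^3^3 \<Rightarrow> real" where
  "frank_form' K11 K22 K33 K24 n M n1 M1 =
     K11 * trace M * trace M1
     + K22 * (n \<bullet> curl_matrix M) * (n1 \<bullet> curl_matrix M + n \<bullet> curl_matrix M1)
     + K33 * (cross3 n (curl_matrix M)
              \<bullet> (cross3 n1 (curl_matrix M) + cross3 n (curl_matrix M1)))
     + 2 * K24 * (trace (M ** M1) - trace M * trace M1)"

text \<open>The second derivative along a motion with velocity \<open>(n1, M1)\<close>, without the contribution of the
  acceleration, which is \<open>frank_form'\<close> evaluated on it.\<close>

definition frank_form'' ::
    "real \<Rightarrow> real \<Rightarrow> real \<Rightarrow> real \<Rightarrow> real^3 \<Rightarrow> real^3^3 \<Rightarrow> real^3 \<Rightarrow> real^3^3 \<Rightarrow> real" where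
  "frank_form'' K11 K22 K33 K24 n M n1 M1 =
     (K11 - 2 * K24) * (trace M1)\<^sup>2
     + K22 * ((n1 \<bullet> curl_matrix M + n \<bullet> curl_matrix M1)\<^sup>2
              + 2 * (n \<bullet> curl_matrix M) * (n1 \<bullet> curl_matrix M1))
     + K33 * ((norm (cross3 n1 (curl_matrix M) + cross3 n (curl_matrix M1)))\<^sup>2
              + 2 * (cross3 n (curl_matrix M) \<bullet> cross3 n1 (curl_matrix M1)))
     + 2 * K24 * trace (M1 ** M1)"

lemma frank_density_eq:
  "frank_density K11 K22 K33 K24 u x = frank_form K11 K22 K33 K24 (u x) (nabla u x)"
  by (simp add: frank_density_def frank_form_def curl_eq div_field_def)

lemmas frank_continuous_intros = continuous_intros
  bounded_linear.continuous_on[OF bounded_linear_trace]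
  bounded_linear.continuous_on[OF bounded_linear_curl_matrix]
  bounded_bilinear.continuous_on[OF bounded_bilinear_matrix_mult]
  bounded_bilinear.continuous_on[OF bounded_bilinear_cross3]

lemma continuous_on_frank_form:
  assumes "continuous_on S n" "continuous_on S M"
  shows "continuous_on S (\<lambda>z. frank_form K11 K22 K33 K24 (n z) (M z))"
  unfolding frank_form_def by (intro frank_continuous_intros assms)

lemma continuous_on_frank_form':
  assumes "continuous_on S n" "continuous_on S M" "continuous_on S n1" "continuous_on S M1"
  shows "continuous_on S (\<lambda>z. frank_form' K11 K22 K33 K24 (n z) (M z) (n1 z) (M1 z))"
  unfolding frank_form'_def by (intro frank_continuous_intros assms)

lemma continuous_on_frank_form'':
  assumes "continuous_on S n" "continuous_on S M" "continuous_on S n1" "continuous_on S M1"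
  shows "continuous_on S (\<lambda>z. frank_form'' K11 K22 K33 K24 (n z) (M z) (n1 z) (M1 z))"
  unfolding frank_form''_def by (intro frank_continuous_intros assms)

lemmas has_vector_derivative_trace = bounded_linear.has_vector_derivative[OF bounded_linear_trace]
lemmas has_vector_derivative_curl_matrix =
  bounded_linear.has_vector_derivative[OF bounded_linear_curl_matrix]
lemmas has_vector_derivative_matrix_mult =
  bounded_bilinear.has_vector_derivative[OF bounded_bilinear_matrix_mult]
lemmas has_vector_derivative_cross3 =
  bounded_bilinear.has_vector_derivative[OF bounded_bilinear_cross3]
lemmas has_vector_derivative_inner =
  bounded_bilinear.has_vector_derivative[OF bounded_bilinear_inner]

lemma has_real_derivative_frank_form:
  assumes n: "(n has_vector_derivative n1) (at t)" and M: "(M has_vector_derivative M1) (at t)"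
  shows "((\<lambda>s. frank_form K11 K22 K33 K24 (n s) (M s)) has_real_derivative
    frank_form' K11 K22 K33 K24 (n t) (M t) n1 M1) (at t)"
proof -
  note c = has_vector_derivative_curl_matrix[OF M]
  note p = has_vector_derivative_cross3[OF n c]
  \<comment> \<open>The density is a polynomial in these four scalars, so ordinary real
    differentiation finishes once their derivatives are known.\<close>
  note [derivative_intros] =
    has_vector_derivative_trace[OF M, folded has_real_derivative_iff_has_vector_derivative]
    has_vector_derivative_inner[OF n c, folded has_real_derivative_iff_has_vector_derivative]
    has_vector_derivative_inner[OF p p, folded has_real_derivative_iff_has_vector_derivative]
    has_vector_derivative_trace[OF has_vector_derivative_matrix_mult[OF M M],
      folded has_real_derivative_iff_has_vector_derivative]
  show ?thesis
    unfolding frank_form_def frank_form'_def power2_norm_eq_inner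
    by (rule DERIV_cong, (rule derivative_intros)+)
      (simp add: trace_add trace_mul_sym[of M1] inner_commute inner_add_left inner_add_right field_simps)
qed

text \<open>The terms with \<open>n2\<close> and \<open>M2\<close> reassemble
  \<open>frank_form'\<close>. Products of \<open>n1\<close> with \<open>curl_matrix M1\<close> arise
  twice, once from each summand of the bend and twist factors, which explains the factors 2 in
  \<open>frank_form''\<close>.\<close>

lemma has_real_derivative_frank_form':
  assumes n: "(n has_vector_derivative n1 t) (at t)" and M: "(M has_vector_derivative M1 t) (at t)"
    and n1: "(n1 has_vector_derivative n2) (at t)" and M1: "(M1 has_vector_derivative M2) (at t)"
  shows "((\<lambda>s. frank_form' K11 K22 K33 K24 (n s) (M s) (n1 s) (M1 s)) has_real_derivative
    frank_form' K11 K22 K33 K24 (n t) (M t) n2 M2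
    + frank_form'' K11 K22 K33 K24 (n t) (M t) (n1 t) (M1 t)) (at t)"
proof -
  note c = has_vector_derivative_curl_matrix[OF M]
  note c1 = has_vector_derivative_curl_matrix[OF M1]
  note p = has_vector_derivative_cross3[OF n c]
  note p1 = has_vector_derivative_add[OF has_vector_derivative_cross3[OF n1 c] has_vector_derivative_cross3[OF n c1]]
  note [derivative_intros] =
    has_vector_derivative_trace[OF M, folded has_real_derivative_iff_has_vector_derivative]
    has_vector_derivative_trace[OF M1, folded has_real_derivative_iff_has_vector_derivative]
    has_vector_derivative_inner[OF n c, folded has_real_derivative_iff_has_vector_derivative]
    has_vector_derivative_inner[OF n1 c, folded has_real_derivative_iff_has_vector_derivative]
    has_vector_derivative_inner[OF n c1, folded has_real_derivative_iff_has_vector_derivative]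
    has_vector_derivative_inner[OF p p1, folded has_real_derivative_iff_has_vector_derivative]
    has_vector_derivative_trace[OF has_vector_derivative_matrix_mult[OF M M1],
      folded has_real_derivative_iff_has_vector_derivative]
  show ?thesis
    unfolding frank_form'_def frank_form''_def power2_norm_eq_inner
    by (rule DERIV_cong, (rule derivative_intros)+)
      (simp add: trace_add inner_commute inner_add_left inner_add_right power2_eq_square algebra_simps two_mult_vec)
qed

text \<open>The gradient \<open>M\<close> of a unit field \<open>n\<close> satisfies \<open>M\<^sup>T n = 0\<close>.\<close>

lemma matrix_vector_mult_eq_cross_curl:
  fixes M :: "real^3^3"
  assumes "transpose M *v n = 0"
  shows "M *v n = - cross3 n (curl_matrix M)"
  \<comment> \<open>For every \<open>M\<close>, \<open>M *v n - transpose M *v n\<close> equals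
    \<open>cross3 (curl_matrix M) n\<close>; the assumption removes the second term.\<close>
  using assms
  by (simp add: vec_eq_iff forall_3 sum_3 matrix_vector_mult_def transpose_def cross3_def curl_matrix_def algebra_simps)

text \<open>Here \<phi> and \<open>g\<close> stand for v^2 and its gradient. The matrix
  \<open>n $ i * g $ j\<close> has trace \<open>n \<bullet> g\<close> and curl
  \<open>cross3 g n\<close>, and its product with \<open>M\<close> has trace
  \<open>(M *v n) \<bullet> g\<close>. The terms with \<open>K22\<close> and \<open>K33\<close>
  receive \<phi> twice, from the field and from the gradient; those with \<open>K11\<close> and
  \<open>K24\<close> involve the gradient alone.\<close>

lemma frank_form'_acceleration:
  fixes n g :: "real^3" and M :: "real^3^3"
  assumes n: "n \<bullet> n = 1" and M: "transpose M *v n = 0"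
  shows "frank_form' K11 K22 K33 K24 n M (w - \<phi> *\<^sub>R n) (Mw - \<phi> *\<^sub>R M - (\<chi> i j. n $ i * g $ j)) =
    frank_form' K11 K22 K33 K24 n M w Mw
    - (K11 - 2 * K24) * (\<phi> * (trace M)\<^sup>2 + trace M * (n \<bullet> g))
    - 2 * K22 * \<phi> * (n \<bullet> curl_matrix M)\<^sup>2
    - K33 * (cross3 n (curl_matrix M) \<bullet> ((2 * \<phi>) *\<^sub>R cross3 n (curl_matrix M) + g))
    - 2 * K24 * (\<phi> * trace (M ** M) - cross3 n (curl_matrix M) \<bullet> g)"
proof -
  define c where "c = curl_matrix M"
  define p where "p = cross3 n c"
  let ?L = "Mw - \<phi> *\<^sub>R M - (\<chi> i j. n $ i * g $ j)"
  have tr: "trace ?L = trace Mw - \<phi> * trace M - n \<bullet> g"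
    by (simp add: trace_def sum_3 inner_vec_def algebra_simps)
  have "trace (M ** ?L) = trace (M ** Mw) - \<phi> * trace (M ** M) - (M *v n) \<bullet> g"
    by (simp add: trace_def sum_3 inner_vec_def matrix_matrix_mult_def matrix_vector_mult_def algebra_simps)
  then have tr2: "trace (M ** ?L) = trace (M ** Mw) - \<phi> * trace (M ** M) + p \<bullet> g"
    by (simp add: matrix_vector_mult_eq_cross_curl[OF M] p_def c_def)
  have curl: "curl_matrix ?L = curl_matrix Mw - \<phi> *\<^sub>R c - cross3 g n"
    by (simp add: curl_matrix_def c_def cross3_def vec_eq_iff forall_3 algebra_simps)
  have "cross3 n (cross3 g n) = g - (n \<bullet> g) *\<^sub>R n"
    using n by (simp add: cross_triple Lagrange)
  then have cross: "cross3 (w - \<phi> *\<^sub>R n) c + cross3 n (curl_matrix ?L) =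
      cross3 w c + cross3 n (curl_matrix Mw) - (2 * \<phi>) *\<^sub>R p - g + (n \<bullet> g) *\<^sub>R n"
    by (simp add: curl p_def Cross3.left_diff_distrib Cross3.right_diff_distrib cross_mult_left cross_mult_right two_mult_vec)
  \<comment> \<open>The multiple of \<open>n\<close> left over in \<open>cross\<close> is
    annihilated by \<open>p\<close>, and the curl of the rank-one part contributes nothing to the
    twist term.\<close>
  have dots: "p \<bullet> n = 0" "n \<bullet> cross3 g n = 0"
    by (simp_all add: p_def dot_cross_self)
  have tw: "(w - \<phi> *\<^sub>R n) \<bullet> c + n \<bullet> curl_matrix ?L = w \<bullet> c + n \<bullet> curl_matrix Mw - 2 * \<phi> * (n \<bullet> c)"
    unfolding curl by (simp add: dots inner_diff_left inner_diff_right)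
  show ?thesis
    unfolding frank_form'_def c_def[symmetric] p_def[symmetric] tr tr2 tw cross
    by (simp add: dots inner_add_right inner_diff_right power2_eq_square algebra_simps)
qed

section \<open>Derivatives of the energy\<close>

lemma nabla_cong:
  assumes "open B" "\<And>y. y \<in> B \<Longrightarrow> f y = g y" "x \<in> B"
  shows "nabla f x = nabla g x"
proof -
  have "(f has_derivative D) (at x) \<longleftrightarrow> (g has_derivative D) (at x)" for D
    using assms has_derivative_transform_within_open[of f D x UNIV B g]
      has_derivative_transform_within_open[of g D x UNIV B f] by auto
  then show ?thesis
    by (simp add: nabla_def jacobian_def frechet_derivative_def)
qed

lemma nabla_add_scaleR:
  fixes a n :: "real^3 \<Rightarrow> real^3" and f :: "real^3 \<Rightarrow> real"
  assumes "a differentiable (at x)" "f differentiable (at x)" "n differentiable (at x)"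
  shows "nabla (\<lambda>y. a y + f y *\<^sub>R n y) x =
    nabla a x + f x *\<^sub>R nabla n x + (\<chi> i j. n x $ i * grad f x $ j)"
proof -
  obtain Da Df Dn where D: "(a has_derivative Da) (at x)" "(f has_derivative Df) (at x)"
      "(n has_derivative Dn) (at x)"
    using assms by (auto simp: differentiable_def)
  have "((\<lambda>y. a y + f y *\<^sub>R n y) has_derivative (\<lambda>h. Da h + (f x *\<^sub>R Dn h + Df h *\<^sub>R n x))) (at x)"
    by (intro has_derivative_add has_derivative_scaleR D)
  then show ?thesis
    using frechet_derivative_at[OF D(2)]
    by (simp add: nabla_eq[OF D(1)] nabla_eq[OF D(3)] nabla_eq grad_def vec_eq_iff)
qed

text \<open>Since |u|^2 is constant, \<open>u x\<close> is orthogonal to every directional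
  derivative of \<open>u\<close>.\<close>

lemma transpose_nabla_unit_field:
  assumes B: "open B" and u: "\<And>y. y \<in> B \<Longrightarrow> norm (u y) = 1" "u differentiable (at x)" and x: "x \<in> B"
  shows "transpose (nabla u x) *v u x = 0"
proof -
  have "((\<lambda>y. u y \<bullet> u y) has_derivative (\<lambda>h. u x \<bullet> (nabla u x *v h) + (nabla u x *v h) \<bullet> u x)) (at x)"
    using nabla_works[OF u(2)] by (intro has_derivative_inner)
  moreover have "((\<lambda>y. u y \<bullet> u y) has_derivative (\<lambda>h. 0)) (at x)"
    by (rule has_derivative_transform_within_open[OF has_derivative_const[of 1] B x])
      (simp add: u(1) flip: power2_norm_eq_inner)
  ultimately have "(\<lambda>h. u x \<bullet> (nabla u x *v h) + (nabla u x *v h) \<bullet> u x) = (\<lambda>h. 0)"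
    by (rule has_derivative_unique)
  then have "u x \<bullet> (nabla u x *v h) + (nabla u x *v h) \<bullet> u x = 0" for h
    by meson
  then have "u x \<bullet> (nabla u x *v h) = 0" for h
    by (simp add: inner_commute)
  then have "(transpose (nabla u x) *v u x) \<bullet> h = 0" for h
    by (simp add: transpose_matrix_vector dot_lmul_matrix)
  then show ?thesis
    by (metis inner_eq_zero_iff)
qed

lemma frank_energy_first_derivative:
  fixes F V :: "real \<times> (real^3) \<Rightarrow> real^3"
  assumes B: "open B" "bounded B"
    and F: "smooth_on_cylinder c d B F" and V: "smooth_on_cylinder c d B V"
    and F_t: "\<And>t x. t \<in> {c<..<d} \<Longrightarrow> x \<in> B \<Longrightarrow> ((\<lambda>s. F (s, x)) has_vector_derivative V (t, x)) (at t)"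
    and t: "t \<in> {c<..<d}"
  shows "((\<lambda>t. frank_energy K11 K22 K33 K24 B (\<lambda>x. F (t, x))) has_real_derivative
    (LINT x:B|lborel. frank_form' K11 K22 K33 K24 (F (t, x)) (nabla (\<lambda>y. F (t, y)) x)
       (V (t, x)) (nabla (\<lambda>y. V (t, y)) x))) (at t)"
proof -
  from B(1) F obtain M where M: "continuous_on ({c<..<d} \<times> closure B) M"
    "\<And>t x. t \<in> {c<..<d} \<Longrightarrow> x \<in> B \<Longrightarrow> M (t, x) = nabla (\<lambda>y. F (t, y)) x"
    by (rule smooth_up_to_nabla) (rule that)
  from B(1) V obtain M1 where M1: "continuous_on ({c<..<d} \<times> closure B) M1"
    "\<And>t x. t \<in> {c<..<d} \<Longrightarrow> x \<in> B \<Longrightarrow> M1 (t, x) = nabla (\<lambda>y. V (t, y)) x"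
    by (rule smooth_up_to_nabla) (rule that)
  have cont: "continuous_on ({c<..<d} \<times> closure B) F" "continuous_on ({c<..<d} \<times> closure B) V"
    using F V by (auto simp: smooth_up_to_def)
  show ?thesis
    unfolding frank_energy_def frank_density_eq
  proof (rule has_real_derivative_set_integral_extension[OF B])
    show "continuous_on ({c<..<d} \<times> closure B) (\<lambda>z. frank_form K11 K22 K33 K24 (F z) (M z))"
      by (intro continuous_on_frank_form cont M(1))
    show "continuous_on ({c<..<d} \<times> closure B) (\<lambda>z. frank_form' K11 K22 K33 K24 (F z) (M z) (V z) (M1 z))"
      by (intro continuous_on_frank_form' cont M(1) M1(1))
  qed (use M(2) M1(2) t in \<open>auto intro!: has_real_derivative_frank_form F_t
      nabla_time_derivative[OF B(1) F V F_t]\<close>)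
qed

text \<open>Additivity of the integral requires each term to be integrable when the first variation
  along \<open>w\<close> is split off.\<close>

lemma set_integrable_frank_form':
  fixes F V :: "real \<times> (real^3) \<Rightarrow> real^3"
  assumes B: "open B" "bounded B"
    and F: "smooth_on_cylinder c d B F" and V: "smooth_on_cylinder c d B V"
    and t: "t \<in> {c<..<d}"
  shows "set_integrable lborel B (\<lambda>x. frank_form' K11 K22 K33 K24 (F (t, x)) (nabla (\<lambda>y. F (t, y)) x)
      (V (t, x)) (nabla (\<lambda>y. V (t, y)) x))"
    and "set_integrable lborel B (\<lambda>x. frank_form'' K11 K22 K33 K24 (F (t, x)) (nabla (\<lambda>y. F (t, y)) x)
      (V (t, x)) (nabla (\<lambda>y. V (t, y)) x))"
proof -
  from B(1) F obtain M where M: "continuous_on ({c<..<d} \<times> closure B) M"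
    "\<And>t x. t \<in> {c<..<d} \<Longrightarrow> x \<in> B \<Longrightarrow> M (t, x) = nabla (\<lambda>y. F (t, y)) x"
    by (rule smooth_up_to_nabla) (rule that)
  from B(1) V obtain M1 where M1: "continuous_on ({c<..<d} \<times> closure B) M1"
    "\<And>t x. t \<in> {c<..<d} \<Longrightarrow> x \<in> B \<Longrightarrow> M1 (t, x) = nabla (\<lambda>y. V (t, y)) x"
    by (rule smooth_up_to_nabla) (rule that)
  have cont: "continuous_on ({c<..<d} \<times> closure B) F" "continuous_on ({c<..<d} \<times> closure B) V"
    using F V by (auto simp: smooth_up_to_def)
  have slice: "continuous_on (closure B) (\<lambda>x. f (t, x))"
    if "continuous_on ({c<..<d} \<times> closure B) f" for f :: "_ \<Rightarrow> real"
    using t by (intro continuous_on_compose2[OF that]) (auto intro!: continuous_intros)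
  show "set_integrable lborel B (\<lambda>x. frank_form' K11 K22 K33 K24 (F (t, x)) (nabla (\<lambda>y. F (t, y)) x)
      (V (t, x)) (nabla (\<lambda>y. V (t, y)) x))"
    using M(2) M1(2) t
    by (intro set_integrable_extension[OF B slice[OF continuous_on_frank_form'[OF cont(1) M(1) cont(2) M1(1)]]]) auto
  show "set_integrable lborel B (\<lambda>x. frank_form'' K11 K22 K33 K24 (F (t, x)) (nabla (\<lambda>y. F (t, y)) x)
      (V (t, x)) (nabla (\<lambda>y. V (t, y)) x))"
    using M(2) M1(2) t
    by (intro set_integrable_extension[OF B slice[OF continuous_on_frank_form''[OF cont(1) M(1) cont(2) M1(1)]]]) auto
qed

lemma frank_energy_second_derivative:
  fixes F V A :: "real \<times> (real^3) \<Rightarrow> real^3"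
  assumes B: "open B" "bounded B"
    and F: "smooth_on_cylinder c d B F" and V: "smooth_on_cylinder c d B V"
    and A: "smooth_on_cylinder c d B A"
    and F_t: "\<And>t x. t \<in> {c<..<d} \<Longrightarrow> x \<in> B \<Longrightarrow> ((\<lambda>s. F (s, x)) has_vector_derivative V (t, x)) (at t)"
    and V_t: "\<And>t x. t \<in> {c<..<d} \<Longrightarrow> x \<in> B \<Longrightarrow> ((\<lambda>s. V (s, x)) has_vector_derivative A (t, x)) (at t)"
    and t: "t \<in> {c<..<d}"
  shows "((\<lambda>t. LINT x:B|lborel. frank_form' K11 K22 K33 K24 (F (t, x)) (nabla (\<lambda>y. F (t, y)) x)
       (V (t, x)) (nabla (\<lambda>y. V (t, y)) x)) has_real_derivative
    (LINT x:B|lborel. frank_form' K11 K22 K33 K24 (F (t, x)) (nabla (\<lambda>y. F (t, y)) x)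
       (A (t, x)) (nabla (\<lambda>y. A (t, y)) x)
     + frank_form'' K11 K22 K33 K24 (F (t, x)) (nabla (\<lambda>y. F (t, y)) x)
       (V (t, x)) (nabla (\<lambda>y. V (t, y)) x))) (at t)"
proof -
  from B(1) F obtain M where M: "continuous_on ({c<..<d} \<times> closure B) M"
    "\<And>t x. t \<in> {c<..<d} \<Longrightarrow> x \<in> B \<Longrightarrow> M (t, x) = nabla (\<lambda>y. F (t, y)) x"
    by (rule smooth_up_to_nabla) (rule that)
  from B(1) V obtain M1 where M1: "continuous_on ({c<..<d} \<times> closure B) M1"
    "\<And>t x. t \<in> {c<..<d} \<Longrightarrow> x \<in> B \<Longrightarrow> M1 (t, x) = nabla (\<lambda>y. V (t, y)) x"
    by (rule smooth_up_to_nabla) (rule that)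
  from B(1) A obtain M2 where M2: "continuous_on ({c<..<d} \<times> closure B) M2"
    "\<And>t x. t \<in> {c<..<d} \<Longrightarrow> x \<in> B \<Longrightarrow> M2 (t, x) = nabla (\<lambda>y. A (t, y)) x"
    by (rule smooth_up_to_nabla) (rule that)
  have cont: "continuous_on ({c<..<d} \<times> closure B) F" "continuous_on ({c<..<d} \<times> closure B) V"
      "continuous_on ({c<..<d} \<times> closure B) A"
    using F V A by (auto simp: smooth_up_to_def)
  show ?thesis
  proof (rule has_real_derivative_set_integral_extension[OF B])
    show "continuous_on ({c<..<d} \<times> closure B) (\<lambda>z. frank_form' K11 K22 K33 K24 (F z) (M z) (V z) (M1 z))"
      by (intro continuous_on_frank_form' cont M(1) M1(1))
    show "continuous_on ({c<..<d} \<times> closure B) (\<lambda>z. frank_form' K11 K22 K33 K24 (F z) (M z) (A z) (M2 z)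
        + frank_form'' K11 K22 K33 K24 (F z) (M z) (V z) (M1 z))"
      by (intro continuous_on_add continuous_on_frank_form' continuous_on_frank_form'' cont M(1) M1(1) M2(1))
  qed (use M(2) M1(2) M2(2) t in \<open>auto intro!: has_real_derivative_frank_form' F_t V_t
      nabla_time_derivative[OF B(1) F V F_t] nabla_time_derivative[OF B(1) V A V_t]\<close>)
qed

section \<open>Unit fields with prescribed initial velocity\<close>

lemma Ck_up_to_bounded_linear:
  assumes "bounded_linear L"
  shows "Ck_up_to k U C L"
proof (cases k)
  case 0
  then show ?thesis by (simp add: linear_continuous_on[OF assms])
next
  case (Suc k')
  show ?thesis
    unfolding Suc
    by (rule Ck_up_to_SucI[where G = "\<lambda>b x. L b" and D = "\<lambda>x. L"])
      (auto intro: linear_continuous_on[OF assms] Ck_up_to_const bounded_linear_imp_has_derivative[OF assms])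
qed

lemma velocity_eq:
  assumes "((\<lambda>s. N s x) has_vector_derivative V) (at t)"
  shows "velocity N t x = V"
  unfolding velocity_def using assms by (rule vector_derivative_at)

text \<open>The rational parametrization of the circle through \<open>n\<close> with tangent \<open>w\<close> at \<open>n\<close>; unlike the
  one by \<open>cos\<close> and \<open>sin\<close> it is smooth where \<open>w\<close> vanishes.\<close>

lemma exists_unit_field_family:
  fixes n :: "real^3 \<Rightarrow> real^3" and w :: "real^3 \<Rightarrow> real^3"
  assumes B: "open B" and \<epsilon>: "0 < \<epsilon>"
    and n: "smooth_on_cylinder (-\<epsilon>) \<epsilon> B (\<lambda>(t, x). n x)"
    and w: "smooth_on_cylinder (-\<epsilon>) \<epsilon> B (\<lambda>(t, x). w x)"
    and unit: "\<And>x. x \<in> closure B \<Longrightarrow> norm (n x) = 1"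
    and orth: "\<And>x. x \<in> closure B \<Longrightarrow> w x \<bullet> n x = 0"
  obtains N where "unit_field_family B \<epsilon> n N" "\<And>x. velocity N 0 x = w x"
proof
  \<comment> \<open>With u = t w / 2 and q = |u|^2, \<open>N\<close> is the inverse stereographic
    projection ((1 - q) n + 2 u) / (1 + q) from the pole -n; the halving of w makes the initial
    velocity \<open>w\<close>. Differences are written with the factor \<open>-1\<close> to fit the
    closure rules for sums and products.\<close>
  define q where "q t x = (1/4) * (t * t * (w x \<bullet> w x))" for t x
  define N where "N t x = inverse (1 + q t x) *\<^sub>R ((1 + (-1) * q t x) *\<^sub>R n x + t *\<^sub>R w x)" for t x
  let ?U = "{-\<epsilon><..<\<epsilon>} \<times> B" and ?C = "{-\<epsilon><..<\<epsilon>} \<times> closure B"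
  have q_nonneg: "0 \<le> q t x" for t x
    by (simp add: q_def)
  have U: "open ?U"
    using B by (intro open_Times) auto
  have UC: "?U \<subseteq> ?C"
    using closure_subset by blast
  have "Ck_up_to k ?U ?C (\<lambda>z. N (fst z) (snd z))" for k
  proof -
    have nk: "Ck_up_to k ?U ?C (\<lambda>z. n (snd z))" and wk: "Ck_up_to k ?U ?C (\<lambda>z. w (snd z))"
      using n w smooth_up_to_iff_Ck_up_to[OF U] by (auto simp: case_prod_beta')
    have tk: "Ck_up_to k ?U ?C fst"
      by (rule Ck_up_to_bounded_linear) (rule bounded_linear_fst)
    have qk: "Ck_up_to k ?U ?C (\<lambda>z. q (fst z) (snd z))"
      unfolding q_def by (intro Ck_up_to_bilinear[OF bounded_bilinear_mult]
          Ck_up_to_bilinear[OF bounded_bilinear_inner] Ck_up_to_const tk wk)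
    have "Ck_up_to k ?U ?C (\<lambda>z. inverse (1 + q (fst z) (snd z)))"
    proof (rule Ck_up_to_inverse[OF UC])
      show "1 + q (fst z) (snd z) \<noteq> 0" for z
        using q_nonneg[of "fst z" "snd z"] by linarith
    qed (intro Ck_up_to_add Ck_up_to_const qk)
    then show ?thesis
      unfolding N_def
      by (intro Ck_up_to_add Ck_up_to_bilinear[OF bounded_bilinear_scaleR]
          Ck_up_to_bilinear[OF bounded_bilinear_mult] Ck_up_to_const nk wk qk tk)
  qed
  then have smooth: "smooth_up_to ?U ?C (\<lambda>(t, x). N t x)"
    by (subst smooth_up_to_iff_Ck_up_to[OF U]) (simp add: case_prod_beta')
  have norm: "norm (N t x) = 1" if "x \<in> closure B" for t x
  proof -
    have "((1 + (-1) * q t x) *\<^sub>R n x + t *\<^sub>R w x) \<bullet> ((1 + (-1) * q t x) *\<^sub>R n x + t *\<^sub>R w x)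
        = (1 - q t x)\<^sup>2 * (n x \<bullet> n x) + t\<^sup>2 * (w x \<bullet> w x) + 2 * (1 - q t x) * t * (w x \<bullet> n x)"
      by (simp add: inner_add_left inner_add_right inner_commute power2_eq_square algebra_simps)
    \<comment> \<open>As |n| = 1 and w is orthogonal to n, this is (1 - q)^2 + 4 q, because t^2
      |w|^2 = 4 q.\<close>
    also have "\<dots> = (1 + q t x)\<^sup>2"
      using unit[OF that] orth[OF that]
      by (simp add: q_def power2_eq_square norm_eq_1 algebra_simps)
    finally have "(norm ((1 + (-1) * q t x) *\<^sub>R n x + t *\<^sub>R w x))\<^sup>2 = (1 + q t x)\<^sup>2"
      by (simp only: power2_norm_eq_inner)
    then have "norm ((1 + (-1) * q t x) *\<^sub>R n x + t *\<^sub>R w x) = 1 + q t x"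
      using q_nonneg[of t x] by (simp add: power2_eq_iff_nonneg)
    then show ?thesis
      using q_nonneg[of t x] by (simp add: N_def)
  qed
  have "N 0 x = n x" for x
    by (simp add: N_def q_def)
  then show "unit_field_family B \<epsilon> n N"
    using \<epsilon> smooth norm by (simp add: unit_field_family_def)
  show "velocity N 0 x = w x" for x
  proof (rule velocity_eq)
    \<comment> \<open>\<open>q\<close> is quadratic in time, so neither the denominator nor the
      coefficient of \<open>n\<close> contributes to the initial velocity.\<close>
    have q0: "((\<lambda>s. q s x) has_real_derivative 0) (at 0)"
      unfolding q_def by (auto intro!: derivative_eq_intros)
    have "((\<lambda>s. inverse (1 + q s x)) has_real_derivative 0) (at 0)"
      by (rule DERIV_cong, (rule derivative_intros q0)+) (simp_all add: q_def)
    moreover have "((\<lambda>s. (1 + (-1) * q s x) *\<^sub>R n x + s *\<^sub>R w x) has_vector_derivative w x) (at 0)"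
    proof -
      have "((\<lambda>s. 1 + (-1) * q s x) has_real_derivative 0) (at 0)"
        by (rule DERIV_cong, (rule derivative_intros q0)+) simp
      from has_vector_derivative_scaleR[OF this has_vector_derivative_const[of "n x"]]
      have "((\<lambda>s. (1 + (-1) * q s x) *\<^sub>R n x) has_vector_derivative 0) (at 0)"
        by simp
      from has_vector_derivative_add[OF this has_vector_derivative_scaleR[OF DERIV_ident has_vector_derivative_const[of "w x"]]]
      show ?thesis by simp
    qed
    ultimately have "((\<lambda>s. N s x) has_vector_derivative
        inverse (1 + q 0 x) *\<^sub>R w x + 0 *\<^sub>R ((1 + (-1) * q 0 x) *\<^sub>R n x + 0 *\<^sub>R w x)) (at 0)"
      unfolding N_def by (rule has_vector_derivative_scaleR)
    then show "((\<lambda>s. N s x) has_vector_derivative w x) (at 0)"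
      by (simp add: q_def)
  qed
qed

text \<open>The fields at time 0 stay functions on the cylinder, so they can be combined with
  \<open>t\<close> in one calculus. Freezing time maps \<open>(1, 0)\<close> to 0 and fixes each
  \<open>(0, b)\<close>, as \<open>Ck_up_to_compose_linear\<close> requires.\<close>

lemma smooth_on_cylinder_time_slice:
  fixes F :: "real \<times> 'a::euclidean_space \<Rightarrow> 'b::real_normed_vector"
  assumes "open B" "smooth_on_cylinder c d B F" "0 \<in> {c<..<d}"
  shows "smooth_on_cylinder c d B (\<lambda>z. F (0, snd z))"
proof -
  have U: "open ({c<..<d} \<times> B)"
    using assms(1) by (intro open_Times) auto
  show ?thesis
    unfolding smooth_up_to_iff_Ck_up_to[OF U]
  proof
    fix k
    have "bounded_linear (\<lambda>z :: real \<times> 'a. (0 :: real, snd z))"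
      by (intro bounded_linear_Pair bounded_linear_zero bounded_linear_snd)
    then show "Ck_up_to k ({c<..<d} \<times> B) ({c<..<d} \<times> closure B) (\<lambda>z. F (0, snd z))"
      by (rule Ck_up_to_compose_linear)
        (use assms(3) smooth_up_to_imp_Ck_up_to[OF U assms(2)] in \<open>auto simp: Basis_prod_def zero_prod_def\<close>)
  qed
qed

lemma smooth_on_cylinder_differentiable:
  fixes F :: "real \<times> 'a::euclidean_space \<Rightarrow> 'b::real_normed_vector"
  assumes "open B" "smooth_on_cylinder c d B F" "t \<in> {c<..<d}" "x \<in> B"
  shows "(\<lambda>y. F (t, y)) differentiable (at x)"
proof -
  from assms(1,2) obtain V P D where "smooth_on_cylinder c d B V"
    and "\<And>t x. t \<in> {c<..<d} \<Longrightarrow> x \<in> B \<Longrightarrow> ((\<lambda>s. F (s, x)) has_vector_derivative V (t, x)) (at t)"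
    and "\<And>b. b \<in> Basis \<Longrightarrow> smooth_on_cylinder c d B (P b)"
    and D: "\<And>t x. t \<in> {c<..<d} \<Longrightarrow> x \<in> B \<Longrightarrow> ((\<lambda>y. F (t, y)) has_derivative D t x) (at x)"
    and "\<And>t x b. t \<in> {c<..<d} \<Longrightarrow> x \<in> B \<Longrightarrow> b \<in> Basis \<Longrightarrow> D t x b = P b (t, x)"
    by (rule smooth_up_to_cross_section) (rule that)
  show ?thesis
    using D[OF assms(3,4)] by (rule differentiableI)
qed

lemma differentiable_at_cong:
  assumes "f differentiable (at x)" "open S" "x \<in> S" "\<And>y. y \<in> S \<Longrightarrow> f y = g y"
  shows "g differentiable (at x)"
  using assms has_derivative_transform_within_open[of f _ x UNIV S g] unfolding differentiable_def by blast

text \<open>The existence clause supplies a family along which both candidate values are derivatives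
  of the same real function; without it, uniqueness would fail.\<close>

lemma first_variation_eqI:
  assumes "has_first_variation E B n w D"
  shows "first_variation E B n w = D"
  unfolding first_variation_def
proof (rule the_equality)
  show "has_first_variation E B n w D"
    by (rule assms)
  fix D' assume D': "has_first_variation E B n w D'"
  then obtain \<epsilon> N where "unit_field_family B \<epsilon> n N" "\<forall>x\<in>closure B. velocity N 0 x = w x"
    by (auto simp: has_first_variation_def)
  then have "((\<lambda>t. E (N t)) has_real_derivative D) (at 0)" "((\<lambda>t. E (N t)) has_real_derivative D') (at 0)"
    using assms D' by (auto simp: has_first_variation_def)
  then show "D' = D"
    by (rule DERIV_unique[symmetric])
qed

text \<open>The derivative depends on the family only through \<open>n\<close> and \<open>w\<close>,
  which is exactly what makes the first variation well defined.\<close>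

lemma frank_energy_derivative_along_family:
  assumes B: "open B" "bounded B" and N: "unit_field_family B \<epsilon> n N"
    and w: "\<forall>x\<in>closure B. velocity N 0 x = w x"
  shows "((\<lambda>t. frank_energy K11 K22 K33 K24 B (N t)) has_real_derivative
    (LINT x:B|lborel. frank_form' K11 K22 K33 K24 (n x) (nabla n x) (w x) (nabla w x))) (at 0)"
proof -
  define F where "F = (\<lambda>(t, x). N t x)"
  have F: "smooth_on_cylinder (-\<epsilon>) \<epsilon> B F" and zero: "0 \<in> {-\<epsilon><..<\<epsilon>}"
    and F0: "\<And>x. x \<in> closure B \<Longrightarrow> F (0, x) = n x"
    using N by (auto simp: unit_field_family_def F_def)
  from B(1) F obtain V where V: "smooth_on_cylinder (-\<epsilon>) \<epsilon> B V"
    and F_t: "\<And>t x. t \<in> {-\<epsilon><..<\<epsilon>} \<Longrightarrow> x \<in> closure B \<Longrightarrow> ((\<lambda>s. F (s, x)) has_vector_derivative V (t, x)) (at t)"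
    by (rule smooth_up_to_time_derivative) (rule that)
  have F_t': "((\<lambda>s. F (s, x)) has_vector_derivative V (t, x)) (at t)"
    if "t \<in> {-\<epsilon><..<\<epsilon>}" "x \<in> B" for t x
    using F_t that closure_subset by blast
  have V0: "V (0, x) = w x" if "x \<in> closure B" for x
    using velocity_eq[of N x "V (0, x)" 0] F_t[OF zero that] w that by (simp add: F_def)
  have eq: "F (0, x) = n x" "V (0, x) = w x" if "x \<in> B" for x
    using that closure_subset[of B] F0 V0 by auto
  note nabla_eqs = nabla_cong[OF B(1) eq(1)] nabla_cong[OF B(1) eq(2)]
  have "(LINT x:B|lborel. frank_form' K11 K22 K33 K24 (F (0, x)) (nabla (\<lambda>y. F (0, y)) x)
      (V (0, x)) (nabla (\<lambda>y. V (0, y)) x)) =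
    (LINT x:B|lborel. frank_form' K11 K22 K33 K24 (n x) (nabla n x) (w x) (nabla w x))"
    by (rule set_lebesgue_integral_cong) (use B in \<open>auto simp: eq nabla_eqs\<close>)
  with frank_energy_first_derivative[OF B F V F_t' zero, of K11 K22 K33 K24] show ?thesis
    by (simp add: F_def)
qed

section \<open>The second variation\<close>

definition second_variation_density ::
    "real \<Rightarrow> real \<Rightarrow> real \<Rightarrow> real \<Rightarrow> (real^3 \<Rightarrow> real^3) \<Rightarrow> (real^3 \<Rightarrow> real^3) \<Rightarrow> real^3 \<Rightarrow> real"
  where
  "second_variation_density K11 K22 K33 K24 n v x =
    (K11 - 2 * K24) *
               ((div_field v x)\<^sup>2 - (v x \<bullet> v x) * (div_field n x)\<^sup>2
                - div_field n x * (n x \<bullet> grad (\<lambda>y. v y \<bullet> v y) x))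
             + K22 *
               ((v x \<bullet> curl n x + n x \<bullet> curl v x)\<^sup>2
                + 2 * (n x \<bullet> curl n x)
                    * (v x \<bullet> curl v x - (v x \<bullet> v x) * (n x \<bullet> curl n x)))
             + K33 *
               ((norm (cross3 (v x) (curl n x) + cross3 (n x) (curl v x)))\<^sup>2
                + cross3 (n x) (curl n x)
                  \<bullet> (2 *\<^sub>R cross3 (v x) (curl v x)
                     - (2 * (v x \<bullet> v x)) *\<^sub>R cross3 (n x) (curl n x)
                     - grad (\<lambda>y. v y \<bullet> v y) x))
             + 2 * K24 *
               (trace (nabla v x ** nabla v x)
                - (v x \<bullet> v x) * trace (nabla n x ** nabla n x)
                + cross3 (n x) (curl n x) \<bullet> grad (\<lambda>y. v y \<bullet> v y) x)"

text \<open>Solving the product rule for \<open>nabla a\<close> gives the shape treated by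
  \<open>frank_form'_acceleration\<close>, with \<phi> = v^2 and \<open>g\<close> its gradient; the
  corrections found there combine with \<open>frank_form''\<close>.\<close>

lemma second_variation_density_eq:
  fixes n v a w :: "real^3 \<Rightarrow> real^3"
  assumes B: "open B" "x \<in> B" and unit: "\<And>y. y \<in> B \<Longrightarrow> norm (n y) = 1"
    and diff: "n differentiable (at x)" "v differentiable (at x)" "a differentiable (at x)"
    and w: "\<And>y. y \<in> B \<Longrightarrow> w y = a y + (v y \<bullet> v y) *\<^sub>R n y"
  shows "frank_form' K11 K22 K33 K24 (n x) (nabla n x) (a x) (nabla a x)
      + frank_form'' K11 K22 K33 K24 (n x) (nabla n x) (v x) (nabla v x)
      - frank_form' K11 K22 K33 K24 (n x) (nabla n x) (w x) (nabla w x) =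
    second_variation_density K11 K22 K33 K24 n v x"
proof -
  define \<phi> g where "\<phi> = v x \<bullet> v x" and "g = grad (\<lambda>y. v y \<bullet> v y) x"
  have "(\<lambda>y. v y \<bullet> v y) differentiable (at x)"
    using diff(2) by (intro differentiable_inner)
  from nabla_add_scaleR[OF diff(3) this diff(1)] nabla_cong[OF B(1) w B(2)]
  have "nabla w x = nabla a x + \<phi> *\<^sub>R nabla n x + (\<chi> i j. n x $ i * g $ j)"
    by (simp add: \<phi>_def g_def)
  then have na: "nabla a x = nabla w x - \<phi> *\<^sub>R nabla n x - (\<chi> i j. n x $ i * g $ j)"
    by simp
  have a: "a x = w x - \<phi> *\<^sub>R n x"
    using w[OF B(2)] by (simp add: \<phi>_def)
  have nn: "n x \<bullet> n x = 1"
    using unit[OF B(2)] by (simp add: norm_eq_1)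
  have "transpose (nabla n x) *v n x = 0"
    by (rule transpose_nabla_unit_field[OF B(1) _ diff(1) B(2)]) (rule unit)
  note acc = frank_form'_acceleration[OF nn this, where w = "w x" and Mw = "nabla w x" and \<phi> = \<phi> and g = g]
  show ?thesis
    unfolding second_variation_density_def na a acc \<phi>_def[symmetric] g_def[symmetric] frank_form''_def div_field_def curl_eq
    by (simp add: inner_diff_right inner_add_right power2_eq_square algebra_simps)
qed

text \<open>The conjunct \<open>has_first_variation\<close> certifies that the description operator
  in \<open>first_variation\<close> denotes, and \<open>field_differentiable\<close> that
  \<open>deriv\<close> is a genuine derivative throughout the time interval.\<close>

theorem mainTheorem1:
  fixes B :: "(real^3) set"
    and K11 K22 K33 K24 \<epsilon> :: real
    and n v :: "real^3 \<Rightarrow> real^3"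
    and N :: "real \<Rightarrow> real^3 \<Rightarrow> real^3"
  assumes B: "open B" "bounded B"
    and N: "unit_field_family B \<epsilon> n N"
    and v: "\<And>x. x \<in> closure B \<Longrightarrow> v x = velocity N 0 x"
  shows "(\<forall>x\<in>closure B. v x \<bullet> n x = 0) \<and>
    (\<exists>w.
      (\<forall>x\<in>closure B. w x \<bullet> n x = 0 \<and>
         acceleration N 0 x = w x - (v x \<bullet> v x) *\<^sub>R n x) \<and>
      has_first_variation (frank_energy K11 K22 K33 K24 B) B n w
        (first_variation (frank_energy K11 K22 K33 K24 B) B n w) \<and>
      first_variation (frank_energy K11 K22 K33 K24 B) B n w =
        (LINT x:B|lborel.
           K11 * div_field n x * div_field w x
           + K22 * (n x \<bullet> curl n x) * (w x \<bullet> curl n x + n x \<bullet> curl w x)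
           + K33 * (cross3 (n x) (curl n x)
                    \<bullet> (cross3 (w x) (curl n x) + cross3 (n x) (curl w x)))
           + 2 * K24 * (trace (nabla n x ** nabla w x) - div_field n x * div_field w x)) \<and>
      (\<forall>t\<in>{-\<epsilon><..<\<epsilon>}.
         (\<lambda>s. frank_energy K11 K22 K33 K24 B (N s)) field_differentiable (at t)) \<and>
      (deriv (\<lambda>t. frank_energy K11 K22 K33 K24 B (N t)) has_real_derivative
        first_variation (frank_energy K11 K22 K33 K24 B) B n w
        + (LINT x:B|lborel.
             (K11 - 2 * K24) *
               ((div_field v x)\<^sup>2 - (v x \<bullet> v x) * (div_field n x)\<^sup>2
                - div_field n x * (n x \<bullet> grad (\<lambda>y. v y \<bullet> v y) x))
             + K22 *
               ((v x \<bullet> curl n x + n x \<bullet> curl v x)\<^sup>2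
                + 2 * (n x \<bullet> curl n x)
                    * (v x \<bullet> curl v x - (v x \<bullet> v x) * (n x \<bullet> curl n x)))
             + K33 *
               ((norm (cross3 (v x) (curl n x) + cross3 (n x) (curl v x)))\<^sup>2
                + cross3 (n x) (curl n x)
                  \<bullet> (2 *\<^sub>R cross3 (v x) (curl v x)
                     - (2 * (v x \<bullet> v x)) *\<^sub>R cross3 (n x) (curl n x)
                     - grad (\<lambda>y. v y \<bullet> v y) x))
             + 2 * K24 *
               (trace (nabla v x ** nabla v x)
                - (v x \<bullet> v x) * trace (nabla n x ** nabla n x)
                + cross3 (n x) (curl n x) \<bullet> grad (\<lambda>y. v y \<bullet> v y) x)))
        (at 0))"
proof -
  define E where "E = frank_energy K11 K22 K33 K24 B"
  define F where "F = (\<lambda>(t, x). N t x)"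
  have \<epsilon>: "0 < \<epsilon>" and F: "smooth_on_cylinder (-\<epsilon>) \<epsilon> B F" and zero: "0 \<in> {-\<epsilon><..<\<epsilon>}"
    and unit: "\<And>t x. t \<in> {-\<epsilon><..<\<epsilon>} \<Longrightarrow> x \<in> closure B \<Longrightarrow> norm (F (t, x)) = 1"
    and F0: "\<And>x. x \<in> closure B \<Longrightarrow> F (0, x) = n x"
    using N by (auto simp: unit_field_family_def F_def)
  from B(1) F obtain V where V: "smooth_on_cylinder (-\<epsilon>) \<epsilon> B V"
    and F_t: "\<And>t x. t \<in> {-\<epsilon><..<\<epsilon>} \<Longrightarrow> x \<in> closure B \<Longrightarrow> ((\<lambda>s. F (s, x)) has_vector_derivative V (t, x)) (at t)"
    by (rule smooth_up_to_time_derivative) (rule that)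
  from B(1) V obtain A where A: "smooth_on_cylinder (-\<epsilon>) \<epsilon> B A"
    and V_t: "\<And>t x. t \<in> {-\<epsilon><..<\<epsilon>} \<Longrightarrow> x \<in> closure B \<Longrightarrow> ((\<lambda>s. V (s, x)) has_vector_derivative A (t, x)) (at t)"
    by (rule smooth_up_to_time_derivative) (rule that)
  note closure_subset[of B, THEN subsetD, intro]
  have vel: "velocity N t x = V (t, x)" if "t \<in> {-\<epsilon><..<\<epsilon>}" "x \<in> closure B" for t x
    using F_t[OF that] by (intro velocity_eq) (simp add: F_def)
  have V0: "V (0, x) = v x" if "x \<in> closure B" for x
    using vel[OF zero that] v[OF that] by simp
  have acc: "acceleration N 0 x = A (0, x)" if "x \<in> closure B" for x
    unfolding acceleration_def
  proof (rule vector_derivative_at)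
    show "((\<lambda>s. velocity N s x) has_vector_derivative A (0, x)) (at 0)"
      using has_vector_derivative_transform_within_open[OF V_t[OF zero that] _ zero] vel that by simp
  qed
  \<comment> \<open>Proved for all times, not only at 0, because the identity is differentiated once
    more in \<open>AF\<close>.\<close>
  have VF: "V (t, x) \<bullet> F (t, x) = 0" if "t \<in> {-\<epsilon><..<\<epsilon>}" "x \<in> closure B" for t x
  proof -
    have "((\<lambda>s. F (s, x) \<bullet> F (s, x)) has_vector_derivative F (t, x) \<bullet> V (t, x) + V (t, x) \<bullet> F (t, x)) (at t)"
      using F_t[OF that] F_t[OF that] by (rule has_vector_derivative_inner)
    moreover have "((\<lambda>s. F (s, x) \<bullet> F (s, x)) has_vector_derivative 0) (at t)"
      by (rule has_vector_derivative_transform_within_open[OF has_vector_derivative_const[of 1] _ that(1)])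
        (use unit that(2) in \<open>auto simp: norm_eq_1\<close>)
    ultimately have "F (t, x) \<bullet> V (t, x) + V (t, x) \<bullet> F (t, x) = 0"
      by (rule vector_derivative_unique_at)
    then show ?thesis by (simp add: inner_commute)
  qed
  have AF: "A (0, x) \<bullet> F (0, x) + V (0, x) \<bullet> V (0, x) = 0" if x: "x \<in> closure B" for x
  proof -
    have "((\<lambda>s. V (s, x) \<bullet> F (s, x)) has_vector_derivative V (0, x) \<bullet> V (0, x) + A (0, x) \<bullet> F (0, x)) (at 0)"
      using V_t[OF zero x] F_t[OF zero x] by (rule has_vector_derivative_inner)
    moreover have "((\<lambda>s. V (s, x) \<bullet> F (s, x)) has_vector_derivative 0) (at 0)"
      by (rule has_vector_derivative_transform_within_open[OF has_vector_derivative_const[of 0] _ zero])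
        (use VF x in auto)
    ultimately have "V (0, x) \<bullet> V (0, x) + A (0, x) \<bullet> F (0, x) = 0"
      by (rule vector_derivative_unique_at)
    then show ?thesis by simp
  qed
  \<comment> \<open>By \<open>AF\<close> the normal component of \<open>A\<close> at time 0 is minus
    v^2, so this is the tangential part of the acceleration. Writing it with slices of
    \<open>F\<close>, \<open>V\<close> and \<open>A\<close> gives its smoothness directly.\<close>
  define w where "w x = A (0, x) + (V (0, x) \<bullet> V (0, x)) *\<^sub>R F (0, x)" for x
  have w_orth: "w x \<bullet> F (0, x) = 0" if "x \<in> closure B" for x
    using AF[OF that] unit[OF zero that] by (simp add: w_def inner_add_left norm_eq_1)
  have w_smooth: "smooth_on_cylinder (-\<epsilon>) \<epsilon> B (\<lambda>z. w (snd z))"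
  proof -
    have U: "open ({-\<epsilon><..<\<epsilon>} \<times> B)"
      using B(1) by (intro open_Times) auto
    note slice = smooth_up_to_imp_Ck_up_to[OF U smooth_on_cylinder_time_slice[OF B(1) _ zero]]
    show ?thesis
      unfolding smooth_up_to_iff_Ck_up_to[OF U] w_def
      by (intro allI Ck_up_to_add Ck_up_to_bilinear[OF bounded_bilinear_scaleR]
          Ck_up_to_bilinear[OF bounded_bilinear_inner] slice[OF F] slice[OF V] slice[OF A])
  qed
  define D where "D = (LINT x:B|lborel. frank_form' K11 K22 K33 K24 (n x) (nabla n x) (w x) (nabla w x))"
  have "\<exists>N'. unit_field_family B \<epsilon> (\<lambda>x. F (0, x)) N' \<and> (\<forall>x. velocity N' 0 x = w x)"
  proof -
    from B(1) \<epsilon> obtain N' where "unit_field_family B \<epsilon> (\<lambda>x. F (0, x)) N'" "\<And>x. velocity N' 0 x = w x"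
    proof (rule exists_unit_field_family)
      show "smooth_on_cylinder (-\<epsilon>) \<epsilon> B (\<lambda>(t, x). F (0, x))"
        using smooth_on_cylinder_time_slice[OF B(1) F zero] by (simp add: case_prod_beta')
      show "smooth_on_cylinder (-\<epsilon>) \<epsilon> B (\<lambda>(t, x). w x)"
        using w_smooth by (simp add: case_prod_beta')
    qed (use unit zero w_orth in auto)
    then show ?thesis by blast
  qed
  \<comment> \<open>\<open>F (0, x)\<close> may be replaced by \<open>n x\<close> because
    \<open>unit_field_family\<close> evaluates the base field on the closure only.\<close>
  then have "\<exists>N'. unit_field_family B \<epsilon> n N' \<and> (\<forall>x\<in>closure B. velocity N' 0 x = w x)"
    using F0 by (auto simp: unit_field_family_def)
  then have fv: "has_first_variation E B n w D"
    unfolding has_first_variation_def E_def D_def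
    using frank_energy_derivative_along_family[OF B] by blast
  note fv_eq = first_variation_eqI[OF fv]

  have F_tB: "((\<lambda>s. F (s, x)) has_vector_derivative V (t, x)) (at t)"
    and V_tB: "((\<lambda>s. V (s, x)) has_vector_derivative A (t, x)) (at t)"
    if "t \<in> {-\<epsilon><..<\<epsilon>}" "x \<in> B" for t x
    using F_t V_t closure_subset that by blast+
  define G where "G t = (LINT x:B|lborel. frank_form' K11 K22 K33 K24 (F (t, x)) (nabla (\<lambda>y. F (t, y)) x)
       (V (t, x)) (nabla (\<lambda>y. V (t, y)) x))" for t
  have EG: "((\<lambda>t. E (N t)) has_real_derivative G t) (at t)" if "t \<in> {-\<epsilon><..<\<epsilon>}" for t
    using frank_energy_first_derivative[OF B F V F_tB that, of K11 K22 K33 K24]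
    by (simp add: E_def F_def G_def)

  let ?A = "\<lambda>x. frank_form' K11 K22 K33 K24 (F (0, x)) (nabla (\<lambda>y. F (0, y)) x)
      (A (0, x)) (nabla (\<lambda>y. A (0, y)) x)"
  let ?V = "\<lambda>x. frank_form'' K11 K22 K33 K24 (F (0, x)) (nabla (\<lambda>y. F (0, y)) x)
      (V (0, x)) (nabla (\<lambda>y. V (0, y)) x)"
  let ?W = "\<lambda>x. frank_form' K11 K22 K33 K24 (F (0, x)) (nabla (\<lambda>y. F (0, y)) x) (w x) (nabla w x)"
  have GD: "(G has_real_derivative (LINT x:B|lborel. ?A x + ?V x)) (at 0)"
    unfolding G_def by (rule frank_energy_second_derivative[OF B F V A F_tB V_tB zero])
  \<comment> \<open>\<open>deriv\<close> agrees with \<open>G\<close> on the open time interval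
    around 0, so it inherits the derivative there.\<close>
  have derivE: "(deriv (\<lambda>t. E (N t)) has_real_derivative (LINT x:B|lborel. ?A x + ?V x)) (at 0)"
    by (rule has_field_derivative_transform_within_open[OF GD _ zero]) (auto intro!: DERIV_imp_deriv[symmetric] EG)
  have eq: "F (0, x) = n x" "V (0, x) = v x" if "x \<in> B" for x
    using that F0 V0 by auto
  have nabla_eqs: "nabla (\<lambda>y. F (0, y)) x = nabla n x" "nabla (\<lambda>y. V (0, y)) x = nabla v x"
    if "x \<in> B" for x
    using that by (auto intro!: nabla_cong[OF B(1)] eq)
  have "set_integrable lborel B ?W"
    using set_integrable_frank_form'(1)[OF B F w_smooth zero] by simp
  moreover have "(LINT x:B|lborel. ?W x) = D"
    unfolding D_def by (rule set_lebesgue_integral_cong) (use B in \<open>auto simp: eq nabla_eqs\<close>)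
  \<comment> \<open>The first variation along \<open>w\<close> is added and subtracted; what remains
    is identified pointwise below.\<close>
  ultimately have "(LINT x:B|lborel. ?A x + ?V x) = D + (LINT x:B|lborel. ?A x + ?V x - ?W x)"
    using set_integrable_frank_form'[OF B F A zero] set_integrable_frank_form'[OF B F V zero]
    by (simp add: set_integral_diff set_integral_add)
  also have "(LINT x:B|lborel. ?A x + ?V x - ?W x) =
      (LINT x:B|lborel. second_variation_density K11 K22 K33 K24 n v x)"
  proof (intro set_lebesgue_integral_cong allI impI)
    fix x assume x: "x \<in> B"
    have n_diff: "n differentiable (at x)"
      using smooth_on_cylinder_differentiable[OF B(1) F zero x] B(1) x
      by (rule differentiable_at_cong) (rule eq(1))
    have v_diff: "v differentiable (at x)"
      using smooth_on_cylinder_differentiable[OF B(1) V zero x] B(1) x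
      by (rule differentiable_at_cong) (rule eq(2))
    have n_unit: "norm (n y) = 1" if "y \<in> B" for y
      using unit[OF zero, of y] F0[of y] closure_subset that by auto
    show "?A x + ?V x - ?W x = second_variation_density K11 K22 K33 K24 n v x"
      unfolding eq[OF x] nabla_eqs[OF x]
      by (rule second_variation_density_eq[OF B(1) x _ n_diff v_diff])
        (use n_unit eq smooth_on_cylinder_differentiable[OF B(1) A zero x] in \<open>auto simp: w_def\<close>)
  qed (use B in auto)
  finally have second: "(deriv (\<lambda>t. E (N t)) has_real_derivative
      D + (LINT x:B|lborel. second_variation_density K11 K22 K33 K24 n v x)) (at 0)"
    using derivE by simp

  show ?thesis
    unfolding E_def[symmetric]
  proof (intro conjI exI[of _ w])
    show "\<forall>x\<in>closure B. v x \<bullet> n x = 0"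
      using VF[OF zero] V0 F0 by simp
    show "\<forall>x\<in>closure B. w x \<bullet> n x = 0 \<and> acceleration N 0 x = w x - (v x \<bullet> v x) *\<^sub>R n x"
      using w_orth acc V0 F0 by (simp add: w_def)
    show "has_first_variation E B n w (first_variation E B n w)"
      using fv fv_eq by simp
    show "first_variation E B n w =
        (LINT x:B|lborel.
           K11 * div_field n x * div_field w x
           + K22 * (n x \<bullet> curl n x) * (w x \<bullet> curl n x + n x \<bullet> curl w x)
           + K33 * (cross3 (n x) (curl n x)
                    \<bullet> (cross3 (w x) (curl n x) + cross3 (n x) (curl w x)))
           + 2 * K24 * (trace (nabla n x ** nabla w x) - div_field n x * div_field w x))"
      by (simp only: fv_eq D_def frank_form'_def div_field_def curl_eq)
    show "\<forall>t\<in>{-\<epsilon><..<\<epsilon>}. (\<lambda>s. E (N s)) field_differentiable (at t)"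
      using EG unfolding field_differentiable_def by blast
  qed (simp only: fv_eq second[unfolded second_variation_density_def])
qed

end
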